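(* For every integer $r\ge 3$ there is an integer $f(r)$ such that every $2$-edge-connected graph of order at least $f(r)$ contains, as an induced subgraph, one of the following: $K_r$; an $r$-flower; a super-clean pinched ladder of order at least $r$; a chain of $r$ super-clean pinched ladders; or a member of the family $\Theta_r$.
   Context: All graphs are finite and simple. "Contains $X$ as an induced subgraph" means some induced subgraph is isomorphic to $X$ (or to a member of the family $X$). For $r\ge 3$, $\Theta_r$ is the class of graphs consisting of $r$ internally disjoint paths between two specified vertices. An $r$-flower is a graph consisting of $r$ edge-disjoint induced cycles that have exactly one vertex in common (pairwise they meet only in this vertex). A pinched ladder is a triple $(L,P,Q)$ where $L$ is a graph and $P,Q$ are paths in $L$ with the same two distinct end vertices $\sigma$ (the initial vertex) and $\tau$ (the final vertex), such that $V(L)=V(P)\cup V(Q)$, $V(P)\cap V(Q)=\{\sigma,\tau\}$, and either one of $P,Q$ is a single edge $e$ and the other is $L-e$, or both $P$ and $Q$ are induced paths of $L$. The rails are $P-\{\sigma,\tau\}=p_1p_2\dots p_a$ and $Q-\{\sigma,\tau\}=q_1q_2\dots q_b$ (numbered starting next to $\sigma$; one rail may be empty). A rung is an edge with one end on each rail. Two rungs $p_iq_j$ and $p_kq_l$ form a cross if $i<k$ and $l<j$; the cross is trivial if $k=i+1$ and $j=l+1$. An embedded fan is an induced subgraph consisting of a vertex $u$ on one rail (the apex) having at least two neighbours on the other rail, the subpath (rim) of the other rail between the first and last neighbours of $u$, and all edges between $u$ and the rim; it is trivial if it is a triangle. A super-clean pinched ladder is (the graph $L$ of) a pinched ladder all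 of whose crosses and embedded fans are trivial; its order is $|V(L)|$. A chain of $n$ super-clean pinched ladders is a graph $H$ with exactly $n$ blocks $L_1,\dots,L_n$ and distinct vertices $u_1,\dots,u_{n+1}$ such that each $L_i$ is a super-clean pinched ladder with initial vertex $u_i$ and final vertex $u_{i+1}$ (so the block-cutvertex tree is a path and $u_2,\dots,u_n$ are the cutvertices). *)

theory Defs
  imports "HOL-Library.Ramsey"
begin

section \<open>Finite simple graphs\<close>

record 'a graph =
  verts :: "'a set"
  edges :: "'a set set"

definition simple_graph :: "'a graph \<Rightarrow> bool" where
  "simple_graph G \<longleftrightarrow> finite (verts G) \<and> edges G \<subseteq> [verts G]\<^bsup>2\<^esup>"

definition subgraph :: "'a graph \<Rightarrow> 'a graph \<Rightarrow> bool" where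
  "subgraph H G \<longleftrightarrow> simple_graph H \<and> verts H \<subseteq> verts G \<and> edges H \<subseteq> edges G"

definition induced :: "'a graph \<Rightarrow> 'a set \<Rightarrow> 'a graph" where
  "induced G S = \<lparr>verts = S, edges = {e \<in> edges G. e \<subseteq> S}\<rparr>"

definition del_vert :: "'a graph \<Rightarrow> 'a \<Rightarrow> 'a graph" where
  "del_vert G x = induced G (verts G - {x})"

definition del_edges :: "'a graph \<Rightarrow> 'a set set \<Rightarrow> 'a graph" where
  "del_edges G F = \<lparr>verts = verts G, edges = edges G - F\<rparr>"

definition graph_iso :: "'a graph \<Rightarrow> 'b graph \<Rightarrow> bool" where
  "graph_iso G H \<longleftrightarrow>
     (\<exists>f. bij_betw f (verts G) (verts H) \<and> edges H = (\<lambda>e. f ` e) ` edges G)"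

definition contains_induced :: "'a graph \<Rightarrow> 'a graph set \<Rightarrow> bool" where
  "contains_induced G X \<longleftrightarrow> (\<exists>S \<subseteq> verts G. \<exists>H \<in> X. graph_iso (induced G S) H)"

text \<open>A path is given by the list of its vertices in order; a single vertex counts as a path.\<close>

definition path_edges :: "'a list \<Rightarrow> 'a set set" where
  "path_edges xs = {{xs ! i, xs ! Suc i} | i. Suc i < length xs}"

definition path_graph :: "'a list \<Rightarrow> 'a graph" where
  "path_graph xs = \<lparr>verts = set xs, edges = path_edges xs\<rparr>"

definition is_path :: "'a graph \<Rightarrow> 'a \<Rightarrow> 'a list \<Rightarrow> 'a \<Rightarrow> bool" where
  "is_path G s xs t \<longleftrightarrow>
     xs \<noteq> [] \<and> distinct xs \<and> hd xs = s \<and> last xs = t \<and>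
     set xs \<subseteq> verts G \<and> path_edges xs \<subseteq> edges G"

definition is_induced_path :: "'a graph \<Rightarrow> 'a \<Rightarrow> 'a list \<Rightarrow> 'a \<Rightarrow> bool" where
  "is_induced_path G s xs t \<longleftrightarrow> is_path G s xs t \<and> induced G (set xs) = path_graph xs"

text \<open>A cycle is listed without repeating its first vertex at the end.\<close>

definition cycle_edges :: "'a list \<Rightarrow> 'a set set" where
  "cycle_edges xs = insert {last xs, hd xs} (path_edges xs)"

definition is_cycle :: "'a graph \<Rightarrow> 'a list \<Rightarrow> bool" where
  "is_cycle G xs \<longleftrightarrow>
     3 \<le> length xs \<and> distinct xs \<and> set xs \<subseteq> verts G \<and> cycle_edges xs \<subseteq> edges G"

definition is_induced_cycle :: "'a graph \<Rightarrow> 'a list \<Rightarrow> bool" where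
  "is_induced_cycle G xs \<longleftrightarrow> is_cycle G xs \<and> edges (induced G (set xs)) = cycle_edges xs"

definition graph_connected :: "'a graph \<Rightarrow> bool" where
  "graph_connected G \<longleftrightarrow>
     verts G \<noteq> {} \<and> (\<forall>u \<in> verts G. \<forall>v \<in> verts G. \<exists>xs. is_path G u xs v)"

definition k_edge_connected :: "nat \<Rightarrow> 'a graph \<Rightarrow> bool" where
  "k_edge_connected k G \<longleftrightarrow>
     card (verts G) > 1 \<and>
     (\<forall>F \<subseteq> edges G. card F < k \<longrightarrow> graph_connected (del_edges G F))"

definition cutvertex :: "'a graph \<Rightarrow> 'a \<Rightarrow> bool" where
  "cutvertex G x \<longleftrightarrow>
     x \<in> verts G \<and>
     (\<exists>a \<in> verts G - {x}. \<exists>b \<in> verts G - {x}.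
        (\<exists>xs. is_path G a xs b) \<and> \<not> (\<exists>xs. is_path (del_vert G x) a xs b))"

definition nonseparable :: "'a graph \<Rightarrow> bool" where
  "nonseparable B \<longleftrightarrow> graph_connected B \<and> (\<forall>x. \<not> cutvertex B x)"

definition is_block :: "'a graph \<Rightarrow> 'a graph \<Rightarrow> bool" where
  "is_block G B \<longleftrightarrow>
     subgraph B G \<and> nonseparable B \<and>
     (\<forall>B'. subgraph B' G \<and> nonseparable B' \<and> subgraph B B' \<longrightarrow> B' = B)"


section \<open>The unavoidable families\<close>

definition is_complete :: "nat \<Rightarrow> 'a graph \<Rightarrow> bool" where
  "is_complete r K \<longleftrightarrow> finite (verts K) \<and> card (verts K) = r \<and> edges K = [verts K]\<^bsup>2\<^esup>"

definition is_theta :: "nat \<Rightarrow> 'a graph \<Rightarrow> bool" where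
  "is_theta r H \<longleftrightarrow>
     simple_graph H \<and>
     (\<exists>s t P. s \<noteq> t \<and> (\<forall>i<r. is_path H s (P i) t) \<and> inj_on P {..<r} \<and>
        (\<forall>i<r. \<forall>j<r. i \<noteq> j \<longrightarrow> set (P i) \<inter> set (P j) = {s, t}) \<and>
        verts H = (\<Union>i<r. set (P i)) \<and> edges H = (\<Union>i<r. path_edges (P i)))"

definition is_flower :: "nat \<Rightarrow> 'a graph \<Rightarrow> bool" where
  "is_flower r H \<longleftrightarrow>
     simple_graph H \<and>
     (\<exists>v C. (\<forall>i<r. is_induced_cycle H (C i) \<and> v \<in> set (C i)) \<and>
        (\<forall>i<r. \<forall>j<r. i \<noteq> j \<longrightarrow>
           set (C i) \<inter> set (C j) = {v} \<and> cycle_edges (C i) \<inter> cycle_edges (C j) = {}) \<and>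
        verts H = (\<Union>i<r. set (C i)) \<and> edges H = (\<Union>i<r. cycle_edges (C i)))"


subsection \<open>Pinched ladders\<close>

definition rail :: "'a list \<Rightarrow> 'a list" where
  "rail P = butlast (tl P)"

text \<open>At most one of the two rails may be empty. This excludes the degenerate case that \<open>P\<close> and
  \<open>Q\<close> are the same single edge and \<open>L\<close> is a \<open>K\<^sub>2\<close>; without it every path would be a
  chain of pinched ladders.\<close>

definition pinched_ladder :: "'a graph \<Rightarrow> 'a list \<Rightarrow> 'a list \<Rightarrow> 'a \<Rightarrow> 'a \<Rightarrow> bool" where
  "pinched_ladder L P Q s t \<longleftrightarrow>
     simple_graph L \<and> s \<noteq> t \<and> is_path L s P t \<and> is_path L s Q t \<and>
     verts L = set P \<union> set Q \<and> set P \<inter> set Q = {s, t} \<and>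
     (rail P \<noteq> [] \<or> rail Q \<noteq> []) \<and>
     (P = [s, t] \<and> path_graph Q = del_edges L {{s, t}} \<or>
      Q = [s, t] \<and> path_graph P = del_edges L {{s, t}} \<or>
      is_induced_path L s P t \<and> is_induced_path L s Q t)"

definition rung :: "'a graph \<Rightarrow> 'a list \<Rightarrow> 'a list \<Rightarrow> nat \<Rightarrow> nat \<Rightarrow> bool" where
  "rung L P Q i j \<longleftrightarrow>
     i < length (rail P) \<and> j < length (rail Q) \<and> {rail P ! i, rail Q ! j} \<in> edges L"

text \<open>The rungs \<open>p\<^sub>i q\<^sub>j\<close> and \<open>p\<^sub>k q\<^sub>l\<close> form a cross. Rails are indexed from 0, which leaves
  the conditions on crosses unchanged.\<close>

definition cross :: "'a graph \<Rightarrow> 'a list \<Rightarrow> 'a list \<Rightarrow> nat \<Rightarrow> nat \<Rightarrow> nat \<Rightarrow> nat \<Rightarrow> bool" where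
  "cross L P Q i j k l \<longleftrightarrow> rung L P Q i j \<and> rung L P Q k l \<and> i < k \<and> l < j"

definition trivial_cross :: "nat \<Rightarrow> nat \<Rightarrow> nat \<Rightarrow> nat \<Rightarrow> bool" where
  "trivial_cross i j k l \<longleftrightarrow> k = i + 1 \<and> j = l + 1"

text \<open>\<open>R ! i\<close> and \<open>R ! j\<close> are the first and the last neighbour of the apex \<open>u\<close> on the
  rail \<open>R\<close>.\<close>

definition fan_on :: "'a graph \<Rightarrow> 'a \<Rightarrow> 'a list \<Rightarrow> 'a graph \<Rightarrow> bool" where
  "fan_on L u R F \<longleftrightarrow>
     (\<exists>i j. i < j \<and> j < length R \<and> {u, R ! i} \<in> edges L \<and> {u, R ! j} \<in> edges L \<and>
        (\<forall>k < length R. {u, R ! k} \<in> edges L \<longrightarrow> i \<le> k \<and> k \<le> j) \<and>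
        F = induced L (insert u ((!) R ` {i..j})))"

definition embedded_fan :: "'a graph \<Rightarrow> 'a list \<Rightarrow> 'a list \<Rightarrow> 'a graph \<Rightarrow> bool" where
  "embedded_fan L P Q F \<longleftrightarrow>
     (\<exists>u \<in> set (rail P). fan_on L u (rail Q) F) \<or>
     (\<exists>u \<in> set (rail Q). fan_on L u (rail P) F)"

definition super_clean_between :: "'a graph \<Rightarrow> 'a \<Rightarrow> 'a \<Rightarrow> bool" where
  "super_clean_between L s t \<longleftrightarrow>
     (\<exists>P Q. pinched_ladder L P Q s t \<and>
        (\<forall>i j k l. cross L P Q i j k l \<longrightarrow> trivial_cross i j k l) \<and>
        (\<forall>F. embedded_fan L P Q F \<longrightarrow> is_complete 3 F))"

definition super_clean_pinched_ladder :: "'a graph \<Rightarrow> bool" where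
  "super_clean_pinched_ladder L \<longleftrightarrow> (\<exists>s t. super_clean_between L s t)"

definition ladder_chain :: "nat \<Rightarrow> 'a graph \<Rightarrow> bool" where
  "ladder_chain n H \<longleftrightarrow>
     simple_graph H \<and>
     (\<exists>L u. inj_on L {1..n} \<and> {B. is_block H B} = L ` {1..n} \<and> inj_on u {1..n + 1} \<and>
        (\<forall>i \<in> {1..n}. super_clean_between (L i) (u i) (u (i + 1))))"

end

theory Submission
  imports Defs
begin

text \<open>If two vertices \<open>s\<close>, \<open>t\<close> are far apart, take a minimal vertex set \<open>S\<close> such that no edge of
  the subgraph induced by \<open>S\<close> separates them. Splitting at cutvertices, each block is covered by
  two internally disjoint paths, and minimality makes all crosses and fans trivial: a bad cross or
  fan lets us reroute and drop a vertex. So \<open>S\<close> induces a long chain or contains a large ladder.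

  Otherwise the diameter is bounded, so some vertex \<open>v\<close> has large degree. If \<open>G - v\<close> has many
  components, induced cycles through \<open>v\<close> form a flower. If not, some component contains many
  neighbours of \<open>v\<close>. An induced path of that component between two of them that is long yields a
  flower (if \<open>v\<close> has many neighbours on it) or a long induced cycle, which is a ladder. If all
  such paths are short, many of them meet only in a common vertex \<open>w\<close>, and Ramsey's theorem,
  applied to the adjacencies between these paths from \<open>v\<close> to \<open>w\<close>, gives a complete graph or a
  theta.\<close>

section \<open>Paths\<close>

text \<open>What must not separate \<open>s\<close> from \<open>t\<close> is an edge, for three
  reasons: the hypothesis on \<open>G\<close> speaks of edges, the condition passes to both sides of
  a separating vertex, and rerouting a path through the apex of a fan produces two paths that share
  this apex but no edge. A bound on the diameter comes from counting: fewer than \<open>r\<close>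
  ladders with at most \<open>r\<close> vertices each carry a path on at most \<open>r * r\<close>
  vertices. The lemma on many short paths meeting in one vertex is used twice: in \<open>G\<close>,
  where the last edges of such paths produce a vertex of large degree, and in a component of
  \<open>G - v\<close>, where the paths start at neighbours of \<open>v\<close>. In the second use
  Ramsey's theorem has two outcomes. Without edges between the paths, prefixing \<open>v\<close> to
  them and removing chords gives a theta; the edge \<open>vw\<close>, if present, has to be one of
  its paths. With edges between fixed positions, one set of vertices is completely joined to
  another; Ramsey's theorem inside each set gives a clique or two independent sets, and the complete
  bipartite graph with sides 2 and \<open>r\<close> is a theta.\<close>

lemma path_edges_simps [simp]:
  "path_edges [] = {}" "path_edges [x] = {}"
  "path_edges (x # y # zs) = insert {x, y} (path_edges (y # zs))"
proof -
  show "path_edges (x # y # zs) = insert {x, y} (path_edges (y # zs))" (is "?A = ?B")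
  proof
    show "?A \<subseteq> ?B"
    proof
      fix e assume "e \<in> ?A"
      then obtain i where "Suc i < length (x # y # zs)"
        "e = {(x # y # zs) ! i, (x # y # zs) ! Suc i}"
        unfolding path_edges_def by blast
      then show "e \<in> ?B"
        by (cases i) (auto simp: path_edges_def)
    qed
    have "{x, y} \<in> ?A" unfolding path_edges_def by force
    moreover have "path_edges (y # zs) \<subseteq> ?A"
    proof
      fix e assume "e \<in> path_edges (y # zs)"
      then obtain i where "Suc i < length (y # zs)" "e = {(y # zs) ! i, (y # zs) ! Suc i}"
        unfolding path_edges_def by blast
      then show "e \<in> ?A"
        unfolding path_edges_def by (intro CollectI exI[of _ "Suc i"]) auto
    qed
    ultimately show "?B \<subseteq> ?A" by blast
  qed
qed (auto simp: path_edges_def)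

lemma path_edges_Cons:
  "path_edges (x # xs) = (if xs = [] then {} else insert {x, hd xs} (path_edges xs))"
  by (cases xs) auto

lemma path_edges_append:
  "path_edges (xs @ ys) =
     path_edges xs \<union> path_edges ys \<union> (if xs = [] \<or> ys = [] then {} else {{last xs, hd ys}})"
  by (induction xs) (auto simp: path_edges_Cons)

lemma path_edges_rev: "path_edges (rev xs) = path_edges xs"
  by (induction xs) (auto simp: path_edges_Cons path_edges_append last_rev insert_commute)

lemma path_edges_subset: "e \<in> path_edges xs \<Longrightarrow> e \<subseteq> set xs"
  by (auto simp: path_edges_def)

section \<open>Edges of simple graphs and of induced subgraphs\<close>

lemma edges_simple:
  assumes "simple_graph G" "{x, y} \<in> edges G"
  shows "x \<in> verts G \<and> y \<in> verts G \<and> x \<noteq> y"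
proof -
  have "{x, y} \<in> [verts G]\<^bsup>2\<^esup>" using assms unfolding simple_graph_def by blast
  then show ?thesis by simp
qed

lemma edge_simpleE:
  assumes "simple_graph G" "e \<in> edges G"
  obtains x y where "e = {x, y}" "x \<in> verts G" "y \<in> verts G" "x \<noteq> y"
  using assms nsets2_E[of e "verts G"] unfolding simple_graph_def by blast

lemma verts_induced [simp]: "verts (induced G S) = S"
  by (simp add: induced_def)

lemma edges_induced: "edges (induced G S) = {e \<in> edges G. e \<subseteq> S}"
  by (simp add: induced_def)

lemma doubleton_edges_induced [simp]:
  "{x, y} \<in> edges (induced G S) \<longleftrightarrow> {x, y} \<in> edges G \<and> x \<in> S \<and> y \<in> S"
  by (auto simp: edges_induced)

lemma induced_induced: "T \<subseteq> S \<Longrightarrow> induced (induced G S) T = induced G T"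
  by (auto simp: induced_def)

lemma simple_graph_induced: "simple_graph G \<Longrightarrow> S \<subseteq> verts G \<Longrightarrow> simple_graph (induced G S)"
  unfolding simple_graph_def by (auto simp: edges_induced nsets_def intro: finite_subset)

lemma simple_graph_del_edges: "simple_graph G \<Longrightarrow> simple_graph (del_edges G F)"
  unfolding simple_graph_def del_edges_def by auto

lemma contains_inducedI:
  assumes "S \<subseteq> verts G" "induced G S \<in> X"
  shows "contains_induced G X"
proof -
  have "graph_iso (induced G S) (induced G S)"
    unfolding graph_iso_def by (intro exI[of _ id]) auto
  then show ?thesis using assms unfolding contains_induced_def by blast
qed

section \<open>Cutting, gluing and rerouting paths\<close>

lemma is_path_induced:
  "S \<subseteq> verts G \<Longrightarrow> is_path (induced G S) s xs t \<longleftrightarrow> is_path G s xs t \<and> set xs \<subseteq> S"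
  unfolding is_path_def edges_induced using path_edges_subset[of _ xs] by auto blast

lemma is_path_del_edges:
  "is_path (del_edges G F) s xs t \<longleftrightarrow> is_path G s xs t \<and> path_edges xs \<inter> F = {}"
  unfolding is_path_def del_edges_def by auto

lemma is_path_single [simp]: "is_path G s [x] t \<longleftrightarrow> x = s \<and> x = t \<and> x \<in> verts G"
  unfolding is_path_def by auto

lemma is_path_Nil [simp]: "\<not> is_path G s [] t"
  unfolding is_path_def by auto

lemma is_path_Cons:
  "is_path G s (x # xs) t \<longleftrightarrow>
     x = s \<and> x \<in> verts G \<and> x \<notin> set xs \<and>
     (if xs = [] then x = t else {x, hd xs} \<in> edges G \<and> is_path G (hd xs) xs t)"
  unfolding is_path_def by (cases xs) auto

lemma is_path_append:
  "xs \<noteq> [] \<Longrightarrow> ys \<noteq> [] \<Longrightarrow>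
   is_path G s (xs @ ys) t \<longleftrightarrow>
     is_path G s xs (last xs) \<and> is_path G (hd ys) ys t \<and> {last xs, hd ys} \<in> edges G \<and>
     set xs \<inter> set ys = {}"
  unfolding is_path_def by (auto simp: path_edges_append)

lemma is_path_rev: "is_path G s xs t \<Longrightarrow> is_path G t (rev xs) s"
  unfolding is_path_def by (auto simp: path_edges_rev hd_rev last_rev)

lemma is_path_ends:
  "is_path G s xs t \<Longrightarrow> xs \<noteq> [] \<and> hd xs = s \<and> last xs = t \<and> distinct xs \<and> s \<in> set xs \<and> t \<in> set xs"
  unfolding is_path_def by auto

lemma is_path_verts: "is_path G s xs t \<Longrightarrow> set xs \<subseteq> verts G"
  unfolding is_path_def by auto

lemma is_path_path_edges: "is_path G s xs t \<Longrightarrow> path_edges xs \<subseteq> edges G"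
  unfolding is_path_def by auto

lemma is_path_prefix: "is_path G s (xs @ x # ys) t \<Longrightarrow> is_path G s (xs @ [x]) x"
  unfolding is_path_def by (cases xs) (auto simp: path_edges_append path_edges_Cons)

lemma is_path_suffix: "is_path G s (xs @ x # ys) t \<Longrightarrow> is_path G x (x # ys) t"
  unfolding is_path_def by (auto simp: path_edges_append)

lemma is_path_glue:
  "is_path G s (xs @ [x]) x \<Longrightarrow> is_path G x (x # ys) t \<Longrightarrow> set xs \<inter> set ys = {} \<Longrightarrow>
   is_path G s (xs @ x # ys) t"
  unfolding is_path_def by (cases xs) (auto simp: path_edges_append path_edges_Cons)

text \<open>Plain concatenation may repeat vertices. Leaving \<open>xs\<close> at its first vertex
  on \<open>ys\<close> and continuing there keeps the result a path.\<close>

lemma is_path_trans: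
  assumes xs: "is_path G a xs b" and ys: "is_path G b ys c"
  obtains zs where "is_path G a zs c" "set zs \<subseteq> set xs \<union> set ys"
proof -
  have "\<exists>x\<in>set xs. x \<in> set ys" using is_path_ends[OF xs] is_path_ends[OF ys] by blast
  then obtain xs1 y xs2 where 1: "xs = xs1 @ y # xs2" "y \<in> set ys" "\<forall>x\<in>set xs1. x \<notin> set ys"
    using split_list_first_prop[of xs "\<lambda>x. x \<in> set ys"] by blast
  obtain ys1 ys2 where 2: "ys = ys1 @ y # ys2" using split_list[OF 1(2)] by blast
  have "is_path G a (xs1 @ y # ys2) c"
  proof (rule is_path_glue)
    show "is_path G a (xs1 @ [y]) y" using is_path_prefix[OF xs[unfolded 1(1)]] .
    show "is_path G y (y # ys2) c" using is_path_suffix[OF ys[unfolded 2]] .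
    show "set xs1 \<inter> set ys2 = {}" using 1 2 by auto
  qed
  moreover have "set (xs1 @ y # ys2) \<subseteq> set xs \<union> set ys" using 1 2 by auto
  ultimately show ?thesis using that by blast
qed

lemma is_path_take:
  assumes "is_path G s xs t" "i < length xs"
  shows "is_path G s (take (Suc i) xs) (xs ! i)"
  using is_path_prefix[of G s "take i xs" "xs ! i" "drop (Suc i) xs" t] assms
  by (simp add: take_Suc_conv_app_nth flip: id_take_nth_drop)

lemma is_path_drop:
  assumes "is_path G s xs t" "i < length xs"
  shows "is_path G (xs ! i) (drop i xs) t"
  using is_path_suffix[of G s "take i xs" "xs ! i" "drop (Suc i) xs" t] assms
  by (simp add: Cons_nth_drop_Suc flip: id_take_nth_drop)

text \<open>The rerouting tool. With \<open>xs = ys\<close> it shortens a path along a chord; with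
  two different paths it exchanges their tails along a rung.\<close>

lemma is_path_take_drop:
  assumes xs: "is_path G s xs t" and ys: "is_path G s' ys t'"
    and "i < length xs" "j < length ys" "{xs ! i, ys ! j} \<in> edges G"
    and "set (take (Suc i) xs) \<inter> set (drop j ys) = {}"
  shows "is_path G s (take (Suc i) xs @ drop j ys) t'"
proof -
  have 1: "is_path G s (take (Suc i) xs) (xs ! i)" using is_path_take[OF xs assms(3)] .
  have 2: "is_path G (ys ! j) (drop j ys) t'" using is_path_drop[OF ys assms(4)] .
  show ?thesis
    using 1 2 assms is_path_ends[OF 1] is_path_ends[OF 2] by (subst is_path_append) auto
qed

lemma is_path_segment:
  assumes "is_path G s xs t" "i \<le> j" "j < length xs"
  shows "is_path G (xs ! i) (drop i (take (Suc j) xs)) (xs ! j)"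
proof -
  have "is_path G s (take (Suc j) xs) (xs ! j)" using is_path_take[OF assms(1,3)] .
  from is_path_drop[OF this, of i] show ?thesis using assms by simp
qed

text \<open>A shortest path among those inside a given vertex set has no chords.\<close>

lemma induced_path_exists:
  assumes G: "simple_graph G" and xs: "is_path G s xs t"
  obtains ys where "is_induced_path G s ys t" "set ys \<subseteq> set xs" "length ys \<le> length xs"
    "\<And>zs. is_path G s zs t \<Longrightarrow> set zs \<subseteq> set xs \<Longrightarrow> length ys \<le> length zs"
proof -
  define P where "P zs \<longleftrightarrow> is_path G s zs t \<and> set zs \<subseteq> set xs" for zs
  have "P xs" using xs P_def by simp
  then obtain ys where ys: "P ys" "\<And>zs. P zs \<Longrightarrow> length ys \<le> length zs"
    using arg_min_nat_lemma[of P xs length] by blast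
  have p: "is_path G s ys t" "set ys \<subseteq> set xs" using ys P_def by auto
  have "edges (induced G (set ys)) = path_edges ys"
  proof
    show "path_edges ys \<subseteq> edges (induced G (set ys))"
      using is_path_path_edges[OF p(1)] path_edges_subset by (auto simp: edges_induced)
    show "edges (induced G (set ys)) \<subseteq> path_edges ys"
    proof
      fix e assume "e \<in> edges (induced G (set ys))"
      then have e: "e \<in> edges G" "e \<subseteq> set ys" by (auto simp: edges_induced)
      obtain x y where "e = {x, y}" "x \<noteq> y" by (rule edge_simpleE[OF G e(1)])
      moreover from this obtain i' j' where "i' < length ys" "j' < length ys" "x = ys ! i'" "y =
          ys ! j'"
        using e(2) by (auto simp: in_set_conv_nth)
      ultimately have "i' < length ys" "j' < length ys" "i' \<noteq> j'" "e = {ys ! i', ys ! j'}"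
        by auto
      then obtain i j where ij: "i < j" "j < length ys" "e = {ys ! i, ys ! j}"
        by (metis insert_commute linorder_neqE_nat)
      have d: "distinct ys" using is_path_ends[OF p(1)] by blast
      \<comment> \<open>Jumping along the chord from position \<open>i\<close> to position
        \<open>j\<close> saves \<open>j - i - 1\<close> vertices, so minimality leaves only
        consecutive positions.\<close>
      have "set (take (Suc i) ys) \<inter> set (drop j ys) = {}"
        using d ij by (simp add: set_take_disj_set_drop_if_distinct)
      then have "is_path G s (take (Suc i) ys @ drop j ys) t"
        using is_path_take_drop[OF p(1) p(1)] ij e by auto
      moreover have "set (take (Suc i) ys @ drop j ys) \<subseteq> set xs"
        using p(2) by (auto dest: in_set_takeD in_set_dropD)
      ultimately have "length ys \<le> length (take (Suc i) ys @ drop j ys)"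
        using ys(2)[of "take (Suc i) ys @ drop j ys"] unfolding P_def by simp
      then have "j = Suc i" using ij by auto
      then show "e \<in> path_edges ys" using ij unfolding path_edges_def by blast
    qed
  qed
  then have "induced G (set ys) = path_graph ys"
    unfolding path_graph_def by (simp add: induced_def)
  then have "is_induced_path G s ys t" using p unfolding is_induced_path_def by simp
  moreover have "length ys \<le> length xs" using ys(2)[OF \<open>P xs\<close>] .
  moreover have "length ys \<le> length zs" if "is_path G s zs t" "set zs \<subseteq> set xs" for zs
    using ys(2)[of zs] that unfolding P_def by simp
  ultimately show ?thesis using that[of ys] p(2) by simp
qed

lemma induced_path_edge_iff:
  assumes "is_induced_path G s xs t" "i < length xs" "j < length xs"
  shows "{xs ! i, xs ! j} \<in> edges G \<longleftrightarrow> i = Suc j \<or> j = Suc i"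
proof -
  have path: "is_path G s xs t" and eq: "edges (induced G (set xs)) = path_edges xs"
    using assms unfolding is_induced_path_def path_graph_def by (auto simp: induced_def)
  have d: "distinct xs" using is_path_ends[OF path] by blast
  have "{xs ! i, xs ! j} \<in> edges G \<longleftrightarrow> {xs ! i, xs ! j} \<in> path_edges xs"
    using assms unfolding eq[symmetric] by auto
  also have "\<dots> \<longleftrightarrow> i = Suc j \<or> j = Suc i"
    using d assms unfolding path_edges_def by (auto simp: doubleton_eq_iff nth_eq_iff_index_eq)
  finally show ?thesis .
qed

lemma induced_path_segment:
  assumes p: "is_induced_path G s xs t" and "i \<le> j" "j < length xs"
  shows "is_induced_path G (xs ! i) (drop i (take (Suc j) xs)) (xs ! j)" (is "is_induced_path G _
      ?ys _")
proof -
  have path: "is_path G s xs t" and eq: "edges (induced G (set xs)) = path_edges xs"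
    using p unfolding is_induced_path_def path_graph_def by (auto simp: induced_def)
  have d: "distinct xs" using is_path_ends[OF path] by blast
  have seg: "is_path G (xs ! i) ?ys (xs ! j)" using is_path_segment[OF path assms(2,3)] .
  have sub: "set ?ys \<subseteq> set xs" by (auto dest: in_set_takeD in_set_dropD)
  have nth: "?ys ! k = xs ! (i + k)" if "k < Suc j - i" for k using that assms by simp
  have len: "length ?ys = Suc j - i" using assms by simp
  have "edges (induced G (set ?ys)) = path_edges ?ys"
  proof
    show "path_edges ?ys \<subseteq> edges (induced G (set ?ys))"
      using is_path_path_edges[OF seg] path_edges_subset by (auto simp: edges_induced)
    show "edges (induced G (set ?ys)) \<subseteq> path_edges ?ys"
    proof
      fix e assume "e \<in> edges (induced G (set ?ys))"
      then have e: "e \<in> path_edges xs" "e \<subseteq> set ?ys"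
        using sub unfolding eq[symmetric] by (auto simp: edges_induced)
      then obtain k where k: "Suc k < length xs" "e = {xs ! k, xs ! Suc k}"
        unfolding path_edges_def by blast
      then have "xs ! k \<in> set ?ys" "xs ! Suc k \<in> set ?ys" using e by auto
      then obtain a b where ab: "a < length ?ys" "b < length ?ys" "?ys ! a = xs ! k" "?ys ! b = xs
          ! Suc k"
        by (metis in_set_conv_nth)
      then have "xs ! (i + a) = xs ! k" "xs ! (i + b) = xs ! Suc k" using nth len by auto
      then have "i + a = k" "i + b = Suc k"
        using d k ab len assms by (auto simp: nth_eq_iff_index_eq)
      then have "b = Suc a" by simp
      then show "e \<in> path_edges ?ys" using ab k unfolding path_edges_def by (intro CollectI exI[of
          _ a]) auto
    qed
  qed
  then have "induced G (set ?ys) = path_graph ?ys"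
    unfolding path_graph_def by (simp add: induced_def)
  then show ?thesis using seg unfolding is_induced_path_def by simp
qed

section \<open>Two internally disjoint paths\<close>

text \<open>The closed pair of paths \<open>A\<close>, \<open>B\<close> is pushed along a fixed path \<open>x # T\<close> towards \<open>t\<close>: a path
  that avoids \<open>x\<close> must jump from \<open>A \<union> B\<close> to a later vertex \<open>z\<close> of \<open>T\<close>.\<close>

lemma disjoint_paths_extend:
  assumes avoid: "\<And>x. x \<in> verts H \<Longrightarrow> x \<noteq> s \<Longrightarrow> x \<noteq> t \<Longrightarrow> \<exists>xs. is_path H s xs t \<and> x \<notin> set xs"
  shows "is_path H s A x \<Longrightarrow> is_path H s B x \<Longrightarrow> set A \<inter> set B = {s, x} \<Longrightarrow> x \<noteq> s \<Longrightarrow>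
    is_path H x (x # T) t \<Longrightarrow> set T \<inter> (set A \<union> set B) = {} \<Longrightarrow>
    \<exists>P Q. is_path H s P t \<and> is_path H s Q t \<and> set P \<inter> set Q = {s, t}"
proof (induction T arbitrary: A B x rule: length_induct)
  case (1 T)
  note AB = 1(2-7)
  show ?case
  proof (cases "T = []")
    case True
    then have "x = t" using AB(5) by simp
    then show ?thesis using AB by blast
  next
    case False
    have xT: "x \<notin> set T" and tT: "t \<in> set T"
      using is_path_ends[OF AB(5)] False by (auto split: if_splits)
    have "x \<in> verts H" "x \<noteq> t" using is_path_verts[OF AB(5)] xT tT by auto
    then obtain R where R: "is_path H s R t" "x \<notin> set R" using avoid[of x] AB(4) by blast
    have sR: "s \<in> set R" "t \<in> set R" "hd R = s" "R \<noteq> []" using is_path_ends[OF R(1)] by auto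
    have "\<exists>z\<in>set R. z \<in> set T" using sR tT by blast
    then obtain R1 z R2 where R1: "R = R1 @ z # R2" "z \<in> set T" "\<forall>u\<in>set R1. u \<notin> set T"
      using split_list_first_prop[of R "\<lambda>z. z \<in> set T"] by blast
    have sA: "s \<in> set A" "s \<in> set B" using is_path_ends[OF AB(1)] is_path_ends[OF AB(2)] by auto
    have sT: "s \<notin> set T" using sA AB(6) by blast
    then have "R1 \<noteq> []" using R1 sR by auto
    then have "s \<in> set R1" using R1 sR by (metis hd_append hd_in_set)
    then have "\<exists>y\<in>set R1. y \<in> set A \<union> set B" using sA by blast
    \<comment> \<open>The vertex \<open>z\<close> is the first of \<open>R\<close> on
      \<open>T\<close>, and \<open>y\<close> is the last one before \<open>z\<close> on
      \<open>A\<close> or \<open>B\<close>. Hence the piece \<open>R4\<close> between them avoids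
      \<open>A\<close>, \<open>B\<close> and \<open>T\<close>.\<close>
    then obtain R3 y R4 where R3: "R1 = R3 @ y # R4" "y \<in> set A \<union> set B"
      "\<forall>u\<in>set R4. u \<notin> set A \<union> set B"
      using split_list_last_prop[of R1 "\<lambda>y. y \<in> set A \<union> set B"] by blast
    have yx: "y \<noteq> x" using R(2) R1 R3 by auto
    have "is_path H s (R1 @ [z]) z" using is_path_prefix[OF R(1)[unfolded R1(1)]] .
    then have "is_path H s (R3 @ y # (R4 @ [z])) z" unfolding R3(1) by simp
    then have D: "is_path H y (y # (R4 @ [z])) z" by (rule is_path_suffix)
    obtain T1 T2 where T: "T = T1 @ z # T2" using split_list[OF R1(2)] by blast
    have xz: "is_path H x (x # T1 @ z # T2) t" using AB(5) T by simp
    then have T1: "is_path H x ((x # T1) @ [z]) z" using is_path_prefix[of H x "x # T1" z T2 t] by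
        simp
    have T2: "is_path H z (z # T2) t" using is_path_suffix[of H x "x # T1" z T2 t] xz by simp
    have dT: "distinct T" using is_path_ends[OF AB(5)] by simp
    \<comment> \<open>The path through \<open>y\<close> leaves for \<open>z\<close> along
      \<open>R4\<close>, the other one runs to \<open>x\<close> and follows the fixed path to
      \<open>z\<close>. This is a closed pair at \<open>z\<close> with a shorter rest
      \<open>T2\<close>. The roles of \<open>A\<close> and \<open>B\<close> depend on where
      \<open>y\<close> lies, so both are generalised here.\<close>
    have step: ?thesis if yA: "y \<in> set A" and A: "is_path H s A x" and B: "is_path H s B x"
      and I: "set A \<inter> set B = {s, x}" and dis: "set T \<inter> (set A \<union> set B) = {}"
      and R4: "\<forall>u\<in>set R4. u \<notin> set A \<union> set B" for A B
    proof -
      obtain A1 A2 where A12: "A = A1 @ y # A2" using split_list[OF yA] by blast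
      have A1: "is_path H s (A1 @ [y]) y" using is_path_prefix[OF A[unfolded A12]] .
      have xA: "x \<in> set A2" "distinct A"
        using is_path_ends[OF A] yx unfolding A12 by (auto split: if_splits)
      have sA1: "s \<in> set (A1 @ [y])" using is_path_ends[OF A1] by simp
      have zA: "z \<notin> set A" "z \<notin> set B" using dis R1(2) by auto
      have 1: "is_path H s (A1 @ y # (R4 @ [z])) z"
        by (rule is_path_glue[OF A1 D]) (use R4 zA A12 in auto)
      obtain B0 where B0: "B = B0 @ [x]" using is_path_ends[OF B] append_butlast_last_id by metis
      have 2: "is_path H s (B0 @ x # (T1 @ [z])) z"
        by (rule is_path_glue) (use B B0 T1 T dis in auto)
      have "set (A1 @ [y]) \<inter> set B \<subseteq> {s}" using I xA A12 by auto
      then have 3: "set (A1 @ y # (R4 @ [z])) \<inter> set (B0 @ x # (T1 @ [z])) = {s, z}"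
        using R4 R1(3) R3(1) dis zA dT B0 sA1 is_path_ends[OF B] unfolding T A12 by auto
      have 4: "set T2 \<inter> (set (A1 @ y # (R4 @ [z])) \<union> set (B0 @ x # (T1 @ [z]))) = {}"
        using R1(3) R3(1) dis dT B0 unfolding T A12 by auto
      have "length T2 < length T" "z \<noteq> s" using T sT R1(2) by auto
      then show ?thesis using "1.IH" 1 2 3 4 T2 by blast
    qed
    from R3(2) show ?thesis
    proof
      assume "y \<in> set A" then show ?thesis using step[of A B] AB R3(3) by blast
    next
      assume "y \<in> set B" then show ?thesis using step[of B A] AB R3(3) by blast
    qed
  qed
qed

text \<open>Menger's theorem for two paths. The pushing starts with \<open>A = B = [s, x]\<close>,
  where \<open>x\<close> is the second vertex of any path; only common vertices are restricted, so
  this degenerate pair is admissible. For adjacent ends the outcome may be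
  \<open>P = Q = [s, t]\<close>, so \<open>chain_exists\<close> treats them separately.\<close>

lemma two_disjoint_paths:
  assumes avoid: "\<And>x. x \<in> verts H \<Longrightarrow> x \<noteq> s \<Longrightarrow> x \<noteq> t \<Longrightarrow> \<exists>xs. is_path H s xs t \<and> x \<notin> set xs"
    and p: "is_path H s xs t" and "s \<noteq> t"
  obtains P Q where "is_path H s P t" "is_path H s Q t" "set P \<inter> set Q = {s, t}"
proof -
  have "hd xs = s" "xs \<noteq> []" "last xs = t" using is_path_ends[OF p] by auto
  then obtain x T where xs: "xs = s # x # T" using \<open>s \<noteq> t\<close>
    by (cases xs; cases "tl xs") auto
  have "is_path H x (x # T) t" using is_path_suffix[of H s "[s]" x T t] p xs by simp
  moreover have "is_path H s [s, x] x" using is_path_prefix[of H s "[s]" x T t] p xs by simp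
  moreover have "x \<noteq> s" "set T \<inter> {s, x} = {}" using is_path_ends[OF p] xs by auto
  ultimately show ?thesis
    using disjoint_paths_extend[OF avoid, of "[s, x]" x "[s, x]" T] that by auto
qed

section \<open>Super-clean pinched ladders\<close>

text \<open>The edge \<open>st\<close> is taken as one of the two paths. Its rail is empty, so there
  are no rungs, and crosses and fans are absent for that reason.\<close>

lemma super_clean_cycle:
  assumes G: "simple_graph G" and Q: "is_path G s Q t" "3 \<le> length Q"
    and E: "edges (induced G (set Q)) = insert {s, t} (path_edges Q)"
  shows "super_clean_between (induced G (set Q)) s t"
proof -
  let ?L = "induced G (set Q)"
  have sub: "set Q \<subseteq> verts G" using is_path_verts[OF Q(1)] .
  have ends: "hd Q = s" "last Q = t" "distinct Q" "Q \<noteq> []" "s \<in> set Q" "t \<in> set Q"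
    using is_path_ends[OF Q(1)] by auto
  have s0: "s = Q ! 0" using ends hd_conv_nth by metis
  have tl: "t = Q ! (length Q - 1)" using ends last_conv_nth by metis
  have st: "s \<noteq> t" using Q(2) ends(3) unfolding s0 tl by (subst nth_eq_iff_index_eq) auto
  have nst: "{s, t} \<notin> path_edges Q"
  proof
    assume "{s, t} \<in> path_edges Q"
    then obtain i where i: "Suc i < length Q" "{Q ! 0, Q ! (length Q - 1)} = {Q ! i, Q ! Suc i}"
      unfolding path_edges_def s0 tl by blast
    then show False using Q(2) ends(3,4)
      by (auto simp: doubleton_eq_iff nth_eq_iff_index_eq)
  qed
  have st_edge: "{s, t} \<in> edges ?L" using E by blast
  have sL: "simple_graph ?L" using simple_graph_induced[OF G sub] .
  have rQ: "rail Q \<noteq> []"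
    using Q(2) unfolding rail_def by (cases Q; cases "tl Q"; cases "tl (tl Q)") auto
  have pinched: "pinched_ladder ?L [s, t] Q s t"
    unfolding pinched_ladder_def
  proof (intro conjI)
    show "is_path ?L s [s, t] t"
      using st ends st_edge unfolding is_path_def by auto
    show "is_path ?L s Q t" using Q(1) is_path_induced[OF sub] by simp
    show "[s, t] = [s, t] \<and> path_graph Q = del_edges ?L {{s, t}} \<or>
      Q = [s, t] \<and> path_graph [s, t] = del_edges ?L {{s, t}} \<or>
      is_induced_path ?L s [s, t] t \<and> is_induced_path ?L s Q t"
      using nst E unfolding path_graph_def del_edges_def by auto
  qed (use sL st ends rQ in auto)
  have r0: "rail [s, t] = []" by (simp add: rail_def)
  show ?thesis unfolding super_clean_between_def
    by (intro exI[of _ "[s, t]"] exI[of _ Q])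
      (use pinched r0 in \<open>auto simp: cross_def rung_def embedded_fan_def fan_on_def\<close>)
qed

lemma super_clean_induced_cycle:
  assumes "simple_graph G" "is_induced_cycle G xs"
  shows "super_clean_pinched_ladder (induced G (set xs))"
proof -
  have "is_path G (hd xs) xs (last xs)"
    using assms(2) unfolding is_induced_cycle_def is_cycle_def is_path_def cycle_edges_def by auto
  then have "super_clean_between (induced G (set xs)) (hd xs) (last xs)"
    using super_clean_cycle[OF assms(1), of "hd xs" xs "last xs"] assms(2)
    unfolding is_induced_cycle_def is_cycle_def cycle_edges_def by (simp add: insert_commute)
  then show ?thesis unfolding super_clean_pinched_ladder_def by blast
qed

section \<open>Rails, and rerouting inside a minimal bridgeless set\<close>

lemma nth_rail: "i < length (rail P) \<Longrightarrow> rail P ! i = P ! Suc i \<and> Suc (Suc i) < length P"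
  unfolding rail_def by (auto simp: nth_butlast nth_tl)

lemma set_rail: "distinct P \<Longrightarrow> P \<noteq> [] \<Longrightarrow> set (rail P) \<subseteq> set P - {hd P, last P}"
proof
  fix x assume d: "distinct P" "P \<noteq> []" and "x \<in> set (rail P)"
  then obtain i where i: "i < length (rail P)" "x = rail P ! i" by (metis in_set_conv_nth)
  then have "x = P ! Suc i" "Suc (Suc i) < length P" using nth_rail by auto
  then show "x \<in> set P - {hd P, last P}"
    using d by (auto simp: hd_conv_nth last_conv_nth nth_eq_iff_index_eq)
qed

text \<open>No edge inside \<open>S\<close> separates \<open>s\<close> from \<open>t\<close>. Since
  \<open>e\<close> ranges over arbitrary sets, this includes that \<open>S\<close> contains a path
  at all. Asking for one path per edge, and not for two edge-disjoint paths, makes the condition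
  split directly at a separating vertex.\<close>

definition bridgeless_between :: "'a graph \<Rightarrow> 'a set \<Rightarrow> 'a \<Rightarrow> 'a \<Rightarrow> bool" where
  "bridgeless_between G S s t \<longleftrightarrow>
     (\<forall>e. \<exists>xs. is_path G s xs t \<and> set xs \<subseteq> S \<and> e \<notin> path_edges xs)"

lemma bridgeless_between_paths:
  assumes "is_path G s P t" "is_path G s Q t" "path_edges P \<inter> path_edges Q = {}"
    "set P \<subseteq> S" "set Q \<subseteq> S"
  shows "bridgeless_between G S s t"
  using assms unfolding bridgeless_between_def by blast

text \<open>A common edge would have both ends in \<open>{s, t}\<close>, so it would be the edge
  \<open>st\<close>.\<close>

lemma path_edges_disjoint:
  assumes "simple_graph G" "is_path G s P t" "set P \<inter> set Q \<subseteq> {s, t}" "{s, t} \<notin> edges G"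
  shows "path_edges P \<inter> path_edges Q = {}"
proof (rule ccontr)
  assume "path_edges P \<inter> path_edges Q \<noteq> {}"
  then obtain e where e: "e \<in> path_edges P" "e \<in> path_edges Q" by blast
  then have eG: "e \<in> edges G" using is_path_path_edges[OF assms(2)] by blast
  have "e \<subseteq> {s, t}" using path_edges_subset e assms(3) by fast
  moreover obtain x y where "e = {x, y}" "x \<noteq> y" by (rule edge_simpleE[OF assms(1) eG])
  ultimately have "e = {s, t}" by auto
  then show False using assms(4) eG by simp
qed

lemma disjoint_if_avoiding_ends:
  "A \<subseteq> P \<Longrightarrow> B \<subseteq> Q \<Longrightarrow> P \<inter> Q \<subseteq> {s, t} \<Longrightarrow> t \<notin> A \<Longrightarrow> s \<notin> B \<Longrightarrow> A \<inter> B = {}"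
  by auto

lemma interior_notin:
  assumes "distinct P" "0 < m" "Suc m < length P" "set P \<inter> set Q = {P ! 0, P ! (length P - 1)}"
  shows "P ! m \<notin> set Q"
proof
  assume "P ! m \<in> set Q"
  then have "P ! m \<in> {P ! 0, P ! (length P - 1)}" using assms(3,4) by (metis IntI Suc_lessD nth_mem)
  moreover have "P \<noteq> []" using assms(3) by auto
  ultimately show False
    using assms(1-3) nth_eq_iff_index_eq[of P m 0] nth_eq_iff_index_eq[of P m "length P - 1"] by
        auto
qed

text \<open>The two rungs exchange the tails of \<open>P\<close> and \<open>Q\<close>. The new paths
  are again disjoint apart from their ends and skip everything strictly between the rungs on both
  rails. Unless the cross is trivial, some vertex is skipped, against minimality.\<close>

lemma minimal_no_bad_cross:
  assumes G: "simple_graph G" and P: "is_path G s P t" and Q: "is_path G s Q t"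
    and PQ: "set P \<inter> set Q = {s, t}" and st: "{s, t} \<notin> edges G"
    and min: "\<And>S'. S' \<subset> set P \<union> set Q \<Longrightarrow> \<not> bridgeless_between G S' s t"
    and c: "cross (induced G (set P \<union> set Q)) P Q i j k l"
  shows "trivial_cross i j k l"
proof (rule ccontr)
  assume nt: "\<not> trivial_cross i j k l"
  have r: "i < length (rail P)" "k < length (rail P)" "j < length (rail Q)" "l < length (rail Q)"
    "i < k" "l < j" using c unfolding cross_def rung_def by auto
  note n = nth_rail[OF r(1)] nth_rail[OF r(2)] nth_rail[OF r(3)] nth_rail[OF r(4)]
  have e: "{P ! Suc i, Q ! Suc j} \<in> edges G" "{Q ! Suc l, P ! Suc k} \<in> edges G"
    using c n unfolding cross_def rung_def by (auto simp: insert_commute)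
  have endsP: "distinct P" "P \<noteq> []" "s = P ! 0" "t = P ! (length P - 1)"
    using is_path_ends[OF P] hd_conv_nth last_conv_nth by metis+
  have endsQ: "distinct Q" "Q \<noteq> []" "s = Q ! 0" "t = Q ! (length Q - 1)"
    using is_path_ends[OF Q] hd_conv_nth last_conv_nth by metis+
  \<comment> \<open>Rail vertex \<open>i\<close> sits at position \<open>Suc i\<close> of
    \<open>P\<close>, because the rail omits \<open>s\<close>; thus
    \<open>take (Suc (Suc i)) P\<close> is the initial part that ends in this rail vertex, and
    \<open>drop (Suc j) Q\<close> starts in rail vertex \<open>j\<close>.\<close>
  let ?P = "take (Suc (Suc i)) P @ drop (Suc j) Q"
  let ?Q = "take (Suc (Suc l)) Q @ drop (Suc k) P"
  have tP: "t \<notin> set (take (Suc (Suc i)) P)"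
    using endsP(1,2,4) n by (auto simp: in_set_conv_nth nth_eq_iff_index_eq)
  have tQ: "t \<notin> set (take (Suc (Suc l)) Q)"
    using endsQ(1,2,4) n by (auto simp: in_set_conv_nth nth_eq_iff_index_eq)
  have sP: "s \<notin> set (drop (Suc k) P)"
    using endsP(1,2,3) n by (auto simp: in_set_conv_nth nth_eq_iff_index_eq)
  have sQ: "s \<notin> set (drop (Suc j) Q)"
    using endsQ(1,2,3) n by (auto simp: in_set_conv_nth nth_eq_iff_index_eq)
  have sub: "set (take (Suc (Suc i)) P) \<subseteq> set P" "set (drop (Suc k) P) \<subseteq> set P"
    "set (take (Suc (Suc l)) Q) \<subseteq> set Q" "set (drop (Suc j) Q) \<subseteq> set Q"
    by (auto dest: in_set_takeD in_set_dropD)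
  have dP: "set (take (Suc (Suc i)) P) \<inter> set (drop (Suc k) P) = {}"
    using endsP(1) r by (simp add: set_take_disj_set_drop_if_distinct)
  have dQ: "set (take (Suc (Suc l)) Q) \<inter> set (drop (Suc j) Q) = {}"
    using endsQ(1) r by (simp add: set_take_disj_set_drop_if_distinct)
  have dPQ: "set (take (Suc (Suc i)) P) \<inter> set (drop (Suc j) Q) = {}"
    using PQ tP sQ sub by (intro disjoint_if_avoiding_ends[of _ "set P" _ "set Q" s t]) auto
  have dQP: "set (take (Suc (Suc l)) Q) \<inter> set (drop (Suc k) P) = {}"
    using PQ tQ sP sub by (intro disjoint_if_avoiding_ends[of _ "set Q" _ "set P" s t]) auto
  have P': "is_path G s ?P t"
    using is_path_take_drop[OF P Q, of "Suc i" "Suc j"] n e dPQ by auto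
  have Q': "is_path G s ?Q t"
    using is_path_take_drop[OF Q P, of "Suc l" "Suc k"] n e dQP by auto
  have "set ?P \<inter> set ?Q \<subseteq> {s, t}"
  proof
    fix x assume "x \<in> set ?P \<inter> set ?Q"
    then have "x \<in> set P \<inter> set Q" using dP dQ sub by auto
    then show "x \<in> {s, t}" using PQ by simp
  qed
  then have "path_edges ?P \<inter> path_edges ?Q = {}" using path_edges_disjoint[OF G P' _ st] by blast
  then have "bridgeless_between G (set ?P \<union> set ?Q) s t"
    using bridgeless_between_paths[OF P' Q'] by blast
  moreover have "set ?P \<union> set ?Q \<subset> set P \<union> set Q"
  proof -
    have "set ?P \<union> set ?Q \<subseteq> set P \<union> set Q" using sub by auto
    \<comment> \<open>The skipped vertex is the rail neighbour just after the first rung on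
      \<open>P\<close> if the ends on \<open>P\<close> are not consecutive, and otherwise the one
      after index \<open>l\<close> on \<open>Q\<close>.\<close>
    moreover have "\<exists>x \<in> set P \<union> set Q. x \<notin> set ?P \<union> set ?Q"
    proof (cases "k = i + 1")
      case False
      have x: "P ! Suc (Suc i) \<in> set P" "P ! Suc (Suc i) \<notin> set Q"
        using interior_notin[of P "Suc (Suc i)" Q] PQ endsP n r(5) False by auto
      moreover have "P ! Suc (Suc i) \<notin> set (take (Suc (Suc i)) P)"
        using endsP n r(5) by (auto simp: in_set_conv_nth nth_eq_iff_index_eq)
      moreover have "P ! Suc (Suc i) \<notin> set (drop (Suc k) P)"
        using endsP n r(5) False by (auto simp: in_set_conv_nth nth_eq_iff_index_eq)
      ultimately show ?thesis using sub by auto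
    next
      case True
      then have jl: "j \<noteq> l + 1" using nt unfolding trivial_cross_def by simp
      have x: "Q ! Suc (Suc l) \<in> set Q" "Q ! Suc (Suc l) \<notin> set P"
        using interior_notin[of Q "Suc (Suc l)" P] PQ endsQ n r(6) jl by (auto simp: Int_commute)
      moreover have "Q ! Suc (Suc l) \<notin> set (take (Suc (Suc l)) Q)"
        using endsQ n r(6) by (auto simp: in_set_conv_nth nth_eq_iff_index_eq)
      moreover have "Q ! Suc (Suc l) \<notin> set (drop (Suc j) Q)"
        using endsQ n r(6) jl by (auto simp: in_set_conv_nth nth_eq_iff_index_eq)
      ultimately show ?thesis using sub by auto
    qed
    ultimately show ?thesis by blast
  qed
  ultimately show False using min by blast
qed

lemma path_edges_take: "path_edges (take n xs) \<subseteq> path_edges xs"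
  and path_edges_drop: "path_edges (drop n xs) \<subseteq> path_edges xs"
proof -
  have "path_edges (take n xs) \<union> path_edges (drop n xs) \<subseteq> path_edges (take n xs @ drop n xs)"
    unfolding path_edges_append by blast
  then show "path_edges (take n xs) \<subseteq> path_edges xs" "path_edges (drop n xs) \<subseteq> path_edges xs"
    unfolding append_take_drop_id by blast+
qed

lemma nth_path_edges: "Suc i < length xs \<Longrightarrow> {xs ! i, xs ! Suc i} \<in> path_edges xs"
  unfolding path_edges_def by blast

lemma path_edges_detour:
  "A \<noteq> [] \<Longrightarrow> B \<noteq> [] \<Longrightarrow>
   path_edges (A @ u # B) = path_edges A \<union> path_edges B \<union> {{last A, u}, {u, hd B}}"
  by (auto simp: path_edges_append path_edges_Cons)

text \<open>Here \<open>Q\<close> is rerouted through the apex \<open>u\<close>, from its first to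
  its last neighbour, while \<open>P\<close> stays. Now \<open>u\<close> lies on both paths, but
  they still have no common edge, which is all that \<open>bridgeless_between\<close> asks for. By
  minimality no rim vertex is skipped, so the rim is one edge and the fan a triangle.\<close>

lemma minimal_no_bad_fan:
  assumes G: "simple_graph G" and P: "is_path G s P t" and Q: "is_path G s Q t"
    and PQ: "set P \<inter> set Q = {s, t}" and st: "{s, t} \<notin> edges G"
    and min: "\<And>S'. S' \<subset> set P \<union> set Q \<Longrightarrow> \<not> bridgeless_between G S' s t"
    and u: "u \<in> set (rail P)" and F: "fan_on (induced G (set P \<union> set Q)) u (rail Q) F"
  shows "is_complete 3 F"
proof -
  let ?L = "induced G (set P \<union> set Q)"
  obtain i j where ij: "i < j" "j < length (rail Q)" and e: "{u, rail Q ! i} \<in> edges ?L"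
    "{u, rail Q ! j} \<in> edges ?L" and F: "F = induced ?L (insert u ((!) (rail Q) ` {i..j}))"
    using F unfolding fan_on_def by blast
  have n: "rail Q ! i = Q ! Suc i" "rail Q ! j = Q ! Suc j" "Suc (Suc j) < length Q"
    using nth_rail[of i Q] nth_rail[of j Q] ij by auto
  have endsP: "distinct P" "P \<noteq> []" "hd P = s" "last P = t"
    using is_path_ends[OF P] by auto
  have endsQ: "distinct Q" "Q \<noteq> []" "s = Q ! 0" "t = Q ! (length Q - 1)"
    using is_path_ends[OF Q] hd_conv_nth last_conv_nth by metis+
  have uP: "u \<in> set P" "u \<notin> set Q" using set_rail[OF endsP(1,2)] u PQ endsP by auto
  have QP: "Q ! Suc a \<notin> set P" if "a \<le> j" for a
    using interior_notin[of Q "Suc a" P] PQ endsQ n that by (auto simp: Int_commute)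
  have j: "j = Suc i"
  proof (rule ccontr)
    assume "j \<noteq> Suc i"
    then have ij2: "Suc i < j" using ij by simp
    let ?A = "take (Suc (Suc i)) Q" and ?B = "drop (Suc j) Q"
    have sub: "set ?A \<subseteq> set Q" "set ?B \<subseteq> set Q" by (auto dest: in_set_takeD in_set_dropD)
    have dAB: "set ?A \<inter> set ?B = {}"
      using endsQ(1) ij by (simp add: set_take_disj_set_drop_if_distinct)
    have A: "is_path G s ?A (Q ! Suc i)" using is_path_take[OF Q, of "Suc i"] n ij by simp
    have B: "is_path G (Q ! Suc j) ?B t" using is_path_drop[OF Q, of "Suc j"] n ij by simp
    have eG: "{Q ! Suc i, u} \<in> edges G" "{u, Q ! Suc j} \<in> edges G"
      using e n by (auto simp: insert_commute)
    have hB: "hd ?B = Q ! Suc j" "?B \<noteq> []" and lA: "last ?A = Q ! Suc i" "?A \<noteq> []"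
      using is_path_ends[OF A] is_path_ends[OF B] by auto
    have "is_path G u (u # ?B) t"
      using B hB eG uP sub is_path_verts[OF P] by (subst is_path_Cons) auto
    then have Q': "is_path G s (?A @ u # ?B) t"
      using A lA eG uP sub dAB by (subst is_path_append) auto
    have pe: "path_edges (?A @ u # ?B) =
      path_edges ?A \<union> path_edges ?B \<union> {{Q ! Suc i, u}, {u, Q ! Suc j}}"
      by (simp only: path_edges_detour[OF lA(2) hB(2)] lA(1) hB(1))
    have "path_edges ?A \<union> path_edges ?B \<subseteq> path_edges Q"
      using path_edges_take path_edges_drop by (rule Un_least)
    moreover have "path_edges P \<inter> path_edges Q = {}"
      using path_edges_disjoint[OF G P _ st] PQ by blast
    \<comment> \<open>Each of the two new edges has an end in the interior of \<open>Q\<close>, and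
      this end does not lie on \<open>P\<close>.\<close>
    moreover have "{Q ! Suc i, u} \<notin> path_edges P" "{u, Q ! Suc j} \<notin> path_edges P"
      using QP[of i] QP[of j] ij path_edges_subset[of "{Q ! Suc i, u}" P]
        path_edges_subset[of "{u, Q ! Suc j}" P] by auto
    ultimately have "path_edges P \<inter> path_edges (?A @ u # ?B) = {}" unfolding pe by auto
    then have "bridgeless_between G (set P \<union> set (?A @ u # ?B)) s t"
      using bridgeless_between_paths[OF P Q'] by blast
    moreover have "set P \<union> set (?A @ u # ?B) \<subset> set P \<union> set Q"
    proof -
      have "Q ! Suc (Suc i) \<in> set Q" using n ij2 by simp
      moreover have "Q ! Suc (Suc i) \<notin> set P" using QP ij2 by simp
      moreover have "Q ! Suc (Suc i) \<notin> set ?A" "Q ! Suc (Suc i) \<notin> set ?B"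
        using endsQ n ij2 by (auto simp: in_set_conv_nth nth_eq_iff_index_eq)
      ultimately show ?thesis using sub uP by auto
    qed
    ultimately show False using min by blast
  qed
  have img: "(!) (rail Q) ` {i..j} = {Q ! Suc i, Q ! Suc j}"
  proof -
    have "{i..j} = {i, j}" using j by auto
    then show ?thesis using n by simp
  qed
  let ?V = "{u, Q ! Suc i, Q ! Suc j}"
  have ne: "Q ! Suc i \<noteq> Q ! Suc j" "u \<noteq> Q ! Suc i" "u \<noteq> Q ! Suc j"
    using endsQ n ij uP by (auto simp: nth_eq_iff_index_eq)
  have V: "?V \<subseteq> set P \<union> set Q" using uP n ij by auto
  have q: "{Q ! Suc i, Q ! Suc j} \<in> edges G"
    using is_path_path_edges[OF Q] nth_path_edges[of "Suc i" Q] n j by auto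
  have eF: "edges F = {x \<in> edges G. x \<subseteq> ?V}"
    unfolding F img using V by (auto simp: edges_induced)
  have "edges F = [?V]\<^bsup>2\<^esup>"
  proof
    show "edges F \<subseteq> [?V]\<^bsup>2\<^esup>"
      unfolding eF using G unfolding simple_graph_def nsets_def by auto
    show "[?V]\<^bsup>2\<^esup> \<subseteq> edges F"
    proof
      fix x assume "x \<in> [?V]\<^bsup>2\<^esup>"
      then obtain a b where "x = {a, b}" "a \<in> ?V" "b \<in> ?V" "a \<noteq> b" by (rule nsets2_E)
      then show "x \<in> edges F" unfolding eF using q e n ne by (auto simp: insert_commute)
    qed
  qed
  then show ?thesis unfolding is_complete_def F img using ne by simp
qed

section \<open>Ladders have no cutvertices\<close>

lemma super_clean_ends:
  assumes "super_clean_between L s t"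
  shows "s \<noteq> t \<and> s \<in> verts L \<and> t \<in> verts L"
proof -
  obtain P Q where "pinched_ladder L P Q s t" using assms unfolding super_clean_between_def by blast
  then have "s \<noteq> t" "is_path L s P t" unfolding pinched_ladder_def by auto
  then show ?thesis using is_path_ends[of L s P t] is_path_verts[of L s P t] by auto
qed

lemma super_clean_path:
  assumes "super_clean_between L s t"
  obtains P where "is_path L s P t"
  using assms unfolding super_clean_between_def pinched_ladder_def by blast

lemma is_path_to_end_avoiding:
  assumes p: "is_path L s P t" and a: "a \<in> set P" "a \<noteq> x"
  shows "(\<exists>xs. is_path L a xs t \<and> x \<notin> set xs) \<or> (\<exists>xs. is_path L a xs s \<and> x \<notin> set xs)"
proof -
  obtain P1 P2 where P: "P = P1 @ a # P2" using split_list[OF a(1)] by blast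
  have d: "distinct (P1 @ a # P2)" using is_path_ends[OF p] P by simp
  have 1: "is_path L a (a # P2) t" using is_path_suffix[OF p[unfolded P]] .
  have 2: "is_path L a (rev (P1 @ [a])) s" using is_path_rev[OF is_path_prefix[OF p[unfolded P]]] .
  show ?thesis
  proof (cases "x \<in> set P2")
    case True
    then have "x \<notin> set (rev (P1 @ [a]))" using d a by auto
    then show ?thesis using 2 by blast
  next
    case False
    then have "x \<notin> set (a # P2)" using a by simp
    then show ?thesis using 1 by blast
  qed
qed

text \<open>A pinched ladder has the spanning cycle \<open>P \<union> Q\<close>.\<close>

lemma super_clean_nonseparable:
  assumes "super_clean_between L s t"
  shows "nonseparable L"
proof -
  obtain P Q where pl: "pinched_ladder L P Q s t"
    using assms unfolding super_clean_between_def by blast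
  then have st: "s \<noteq> t" and P: "is_path L s P t" and Q: "is_path L s Q t"
    and V: "verts L = set P \<union> set Q" and PQ: "set P \<inter> set Q = {s, t}"
    unfolding pinched_ladder_def by auto
  have avoid: "\<exists>xs. is_path L a xs b \<and> x \<notin> set xs"
    if a: "a \<in> verts L" "a \<noteq> x" and b: "b \<in> verts L" "b \<noteq> x" for a b x
  proof -
    have to_end: "(\<exists>xs. is_path L c xs t \<and> x \<notin> set xs) \<or> (\<exists>xs. is_path L c xs s \<and> x \<notin> set xs)"
      if "c \<in> verts L" "c \<noteq> x" for c
      using is_path_to_end_avoiding[OF P, of c x] is_path_to_end_avoiding[OF Q, of c x] that V by
          blast
    \<comment> \<open>A hub \<open>h\<close> that every vertex other than \<open>x\<close> reaches
      without meeting \<open>x\<close>: it is \<open>t\<close> if \<open>x = s\<close>, and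
      \<open>s\<close> if \<open>x = t\<close>. Otherwise \<open>t\<close> serves, since one of
      \<open>P\<close> and \<open>Q\<close> misses \<open>x\<close> and leads from \<open>s\<close>
      on to \<open>t\<close>.\<close>
    have "\<exists>h. \<forall>c \<in> verts L - {x}. \<exists>xs. is_path L c xs h \<and> x \<notin> set xs"
    proof (cases "x = s")
      case True
      have "\<not> (is_path L c xs s \<and> x \<notin> set xs)" for c xs
        using True is_path_ends[of L c xs s] by blast
      then show ?thesis using to_end by blast
    next
      case xs: False
      show ?thesis
      proof (cases "x = t")
        case True
        have "\<not> (is_path L c xs t \<and> x \<notin> set xs)" for c xs
          using True is_path_ends[of L c xs t] by blast
        then show ?thesis using to_end by blast
      next
        case False
        then have "x \<notin> set P \<or> x \<notin> set Q" using xs PQ by auto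
        then obtain R where R: "is_path L s R t" "x \<notin> set R" using P Q by blast
        have "\<exists>xs. is_path L c xs t \<and> x \<notin> set xs" if c: "c \<in> verts L - {x}" for c
          using to_end[of c]
        proof
          assume "\<exists>xs. is_path L c xs s \<and> x \<notin> set xs"
          then obtain xs where xs: "is_path L c xs s" "x \<notin> set xs" by blast
          obtain zs where "is_path L c zs t" "set zs \<subseteq> set xs \<union> set R" by (rule is_path_trans[OF
              xs(1) R(1)])
          then show ?thesis using xs R by blast
        qed (use c in auto)
        then show ?thesis by blast
      qed
    qed
    then obtain h where h: "\<And>c. c \<in> verts L - {x} \<Longrightarrow> \<exists>xs. is_path L c xs h \<and> x \<notin> set xs" by blast
    obtain xs where xs: "is_path L a xs h" "x \<notin> set xs" using h[of a] a by blast
    obtain ys where ys: "is_path L b ys h" "x \<notin> set ys" using h[of b] b by blast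
    obtain zs where "is_path L a zs b" "set zs \<subseteq> set xs \<union> set (rev ys)"
      by (rule is_path_trans[OF xs(1) is_path_rev[OF ys(1)]])
    then show ?thesis using xs ys by auto
  qed
  have "graph_connected L"
    unfolding graph_connected_def
  proof (intro conjI ballI)
    show "verts L \<noteq> {}" using V PQ by auto
    fix a b assume ab: "a \<in> verts L" "b \<in> verts L"
    show "\<exists>xs. is_path L a xs b"
    \<comment> \<open>The fact \<open>avoid\<close> needs a vertex \<open>x\<close> different from
      both ends. One of \<open>s\<close> and \<open>t\<close> can play this part unless they are
      themselves the two ends, and then \<open>P\<close> joins them.\<close>
    proof (cases "s \<in> {a, b} \<and> t \<in> {a, b}")
      case True
      then show ?thesis using st P is_path_rev[OF P] by auto
    next
      case False
      then have "\<exists>x. a \<noteq> x \<and> b \<noteq> x" by auto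
      then obtain x where "a \<noteq> x" "b \<noteq> x" by blast
      then show ?thesis using avoid[OF ab(1) _ ab(2)] by blast
    qed
  qed
  moreover have "\<not> cutvertex L x" for x
  proof
    assume "cutvertex L x"
    then obtain a b where ab: "a \<in> verts L - {x}" "b \<in> verts L - {x}"
      "\<not> (\<exists>xs. is_path (del_vert L x) a xs b)" unfolding cutvertex_def by blast
    obtain xs where xs: "is_path L a xs b" "x \<notin> set xs" using avoid[of a x b] ab by blast
    then have "set xs \<subseteq> verts L - {x}" using is_path_verts[OF xs(1)] by blast
    then have "is_path (del_vert L x) a xs b"
      unfolding del_vert_def using xs(1) by (subst is_path_induced) auto
    then show False using ab(3) by blast
  qed
  ultimately show ?thesis unfolding nonseparable_def by blast
qed

section \<open>Chains\<close>

lemma is_path_crossing: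
  "is_path G a xs b \<Longrightarrow> a \<in> X \<Longrightarrow> b \<notin> X \<Longrightarrow>
   \<exists>p\<in>X. \<exists>q. q \<notin> X \<and> {p, q} \<in> edges G \<and> p \<in> set xs \<and> q \<in> set xs"
proof (induction xs arbitrary: a)
  case (Cons x xs)
  have x: "x = a" and ne: "xs \<noteq> []" using Cons.prems by (auto simp: is_path_Cons split: if_splits)
  then have e: "{a, hd xs} \<in> edges G" "is_path G (hd xs) xs b"
    using Cons.prems(1) by (auto simp: is_path_Cons)
  show ?case
  proof (cases "hd xs \<in> X")
    case True
    then show ?thesis using Cons.IH[OF e(2)] Cons.prems(3) by auto
  next
    case False
    then show ?thesis using Cons.prems(2) e(1) x ne
      by (intro bexI[of _ a] exI[of _ "hd xs"]) auto
  qed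
qed auto

text \<open>Every path of \<open>B\<close> from one side to the other passes through
  \<open>u\<close>. If \<open>B\<close> had vertices beyond \<open>u\<close> on both sides, then
  \<open>u\<close> would be a cutvertex of \<open>B\<close>.\<close>

lemma nonseparable_within_side:
  assumes B: "nonseparable B" "subgraph B (induced G (S \<union> T))"
    and u: "S \<inter> T = {u}" and ne: "\<And>a b. a \<in> S - {u} \<Longrightarrow> b \<in> T - {u} \<Longrightarrow> {a, b} \<notin> edges G"
  shows "verts B \<subseteq> S \<or> verts B \<subseteq> T"
proof (rule ccontr)
  assume "\<not> ?thesis"
  then obtain a b where ab: "a \<in> verts B" "a \<notin> S" "b \<in> verts B" "b \<notin> T" by blast
  have V: "verts B \<subseteq> S \<union> T" and E: "edges B \<subseteq> edges G"
    using B(2) unfolding subgraph_def by (auto simp: edges_induced)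
  have b: "b \<in> S - {u}" and a: "a \<notin> S - {u}" using ab V u by auto
  have through: "u \<in> set xs" if xs: "is_path B b xs a" for xs
  proof -
    obtain p q where pq: "p \<in> S - {u}" "q \<notin> S - {u}" "{p, q} \<in> edges B" "q \<in> set xs"
      using is_path_crossing[OF xs b a] by blast
    have "q \<in> S \<union> T" using V is_path_verts[OF xs] pq by blast
    moreover have "q \<notin> T - {u}" using ne[OF pq(1)] pq(3) E by blast
    ultimately have "q = u" using pq u by blast
    then show ?thesis using pq by simp
  qed
  obtain xs where xs: "is_path B b xs a"
    using B(1) ab unfolding nonseparable_def graph_connected_def by blast
  have "u \<in> verts B" using through[OF xs] is_path_verts[OF xs] by blast
  moreover have "\<not> cutvertex B u" using B(1) unfolding nonseparable_def by blast
  moreover have "a \<in> verts B - {u}" "b \<in> verts B - {u}" using ab b u by auto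
  ultimately obtain ys where "is_path (del_vert B u) b ys a"
    using xs unfolding cutvertex_def by blast
  then have "is_path B b ys a" "set ys \<subseteq> verts B - {u}"
    unfolding del_vert_def using is_path_induced[of "verts B - {u}" B] by auto
  then show False using through[of ys] by blast
qed

lemma subgraph_induced_subset:
  assumes "subgraph B (induced G S)" "verts B \<subseteq> T"
  shows "subgraph B (induced G T)"
  using assms unfolding subgraph_def simple_graph_def by (auto simp: edges_induced nsets_def)

lemma subgraph_induced_mono:
  assumes "subgraph B (induced G S)" "S \<subseteq> T"
  shows "subgraph B (induced G T)"
  using assms unfolding subgraph_def by (auto simp: edges_induced)

lemma subgraph_induced_antisym:
  assumes "subgraph B (induced G S)" "subgraph (induced G S) B"
  shows "B = induced G S"
  using assms unfolding subgraph_def by auto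

text \<open>A nonseparable subgraph of the union lies on one side, so maximality in the union can be
  tested on that side. Only a subgraph with no vertex besides \<open>u\<close> could lie on both
  sides; the last assumptions on \<open>T\<close> and on the blocks of \<open>S\<close> exclude
  this.\<close>

lemma blocks_glue:
  assumes G: "simple_graph G" "S \<union> T \<subseteq> verts G"
    and u: "S \<inter> T = {u}" and ne: "\<And>a b. a \<in> S - {u} \<Longrightarrow> b \<in> T - {u} \<Longrightarrow> {a, b} \<notin> edges G"
    and T: "nonseparable (induced G T)" "\<not> T \<subseteq> {u}"
    and S: "\<And>B. is_block (induced G S) B \<Longrightarrow> \<not> verts B \<subseteq> {u}"
  shows "{B. is_block (induced G (S \<union> T)) B} = insert (induced G T) {B. is_block (induced G S) B}"
proof -
  have side: "subgraph B (induced G S) \<or> subgraph B (induced G T)"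
    if "nonseparable B" "subgraph B (induced G (S \<union> T))" for B
    using nonseparable_within_side[OF that u ne] subgraph_induced_subset[OF that(2)] by blast
  have subT: "subgraph (induced G T) (induced G (S \<union> T))"
    using simple_graph_induced[OF G(1), of T] G(2) unfolding subgraph_def
    by (auto simp: edges_induced)
  have "is_block (induced G (S \<union> T)) B \<longleftrightarrow> B = induced G T \<or> is_block (induced G S) B" for B
  proof
    assume B: "is_block (induced G (S \<union> T)) B"
    then have B1: "nonseparable B" "subgraph B (induced G (S \<union> T))"
      and B2: "\<And>B'. subgraph B' (induced G (S \<union> T)) \<Longrightarrow> nonseparable B' \<Longrightarrow> subgraph B B' \<Longrightarrow> B' = B"
      unfolding is_block_def by auto
    show "B = induced G T \<or> is_block (induced G S) B"
      using side[OF B1]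
    proof
      assume "subgraph B (induced G T)"
      then show ?thesis using B2[OF subT T(1)] by simp
    next
      assume "subgraph B (induced G S)"
      then have "is_block (induced G S) B"
        unfolding is_block_def using B1(1) B2 subgraph_induced_mono[of _ G S "S \<union> T"] by auto
      then show ?thesis ..
    qed
  next
    assume "B = induced G T \<or> is_block (induced G S) B"
    then show "is_block (induced G (S \<union> T)) B"
    proof
      assume B: "B = induced G T"
      have "B' = B" if B': "subgraph B' (induced G (S \<union> T))" "nonseparable B'" "subgraph B B'" for
          B'
        using side[OF B'(2,1)]
      proof
        assume "subgraph B' (induced G S)"
        then have "T \<subseteq> S" using B'(3) B unfolding subgraph_def by auto
        then show ?thesis using T(2) u by blast
      next
        assume "subgraph B' (induced G T)"
        then show ?thesis using B'(3) subgraph_induced_antisym unfolding B by blast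
      qed
      then show ?thesis unfolding is_block_def using B subT T(1) by blast
    next
      assume B: "is_block (induced G S) B"
      then have B1: "nonseparable B" "subgraph B (induced G S)"
        and B2: "\<And>B'. subgraph B' (induced G S) \<Longrightarrow> nonseparable B' \<Longrightarrow> subgraph B B' \<Longrightarrow> B' = B"
        unfolding is_block_def by auto
      have "B' = B" if B': "subgraph B' (induced G (S \<union> T))" "nonseparable B'" "subgraph B B'" for
          B'
        using side[OF B'(2,1)]
      proof
        assume "subgraph B' (induced G S)"
        then show ?thesis using B2 B' by blast
      next
        assume "subgraph B' (induced G T)"
        then have "verts B \<subseteq> T" using B'(3) unfolding subgraph_def by auto
        moreover have "verts B \<subseteq> S" using B1(2) unfolding subgraph_def by auto
        ultimately show ?thesis using S[OF B] u by blast
      qed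
      moreover have "subgraph B (induced G (S \<union> T))" using subgraph_induced_mono[OF B1(2)] by blast
      ultimately show ?thesis unfolding is_block_def using B1(1) by blast
    qed
  qed
  then show ?thesis by auto
qed

text \<open>A chain as a vertex set of \<open>G\<close> with named ends, built ladder by ladder.
  Blocks do not occur here: with no edges between the parts away from \<open>u\<close>, the induced
  graph on the union is just the two parts glued, and the blocks can be read off afterwards.\<close>

inductive chain :: "'a graph \<Rightarrow> nat \<Rightarrow> 'a set \<Rightarrow> 'a \<Rightarrow> 'a \<Rightarrow> bool" for G where
  single: "S \<subseteq> verts G \<Longrightarrow> super_clean_between (induced G S) s t \<Longrightarrow> chain G (Suc 0) S s t"
| glue: "chain G n S s u \<Longrightarrow> T \<subseteq> verts G \<Longrightarrow> super_clean_between (induced G T) u t \<Longrightarrow>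
    S \<inter> T = {u} \<Longrightarrow> (\<And>a b. a \<in> S - {u} \<Longrightarrow> b \<in> T - {u} \<Longrightarrow> {a, b} \<notin> edges G) \<Longrightarrow>
    chain G (Suc n) (S \<union> T) s t"

lemma chain_ends: "chain G n S s t \<Longrightarrow> s \<noteq> t \<and> s \<in> S \<and> t \<in> S \<and> S \<subseteq> verts G \<and> 0 < n"
proof (induction rule: chain.induct)
  case (single S s t)
  then show ?case using super_clean_ends[OF single(2)] by simp
next
  case (glue n S s u T t)
  then show ?case using super_clean_ends[OF glue(3)] by auto
qed

text \<open>The rule \<open>glue\<close> adds a single ladder at the far end, so the induction is on
  the second chain, and its ladders are attached to the first one in order.\<close>

lemma chain_append:
  "chain G m T u t \<Longrightarrow> chain G n S s u \<Longrightarrow> S \<inter> T = {u} \<Longrightarrow>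
   (\<And>a b. a \<in> S - {u} \<Longrightarrow> b \<in> T - {u} \<Longrightarrow> {a, b} \<notin> edges G) \<Longrightarrow> chain G (n + m) (S \<union> T) s t"
proof (induction rule: chain.induct)
  case (single T u t)
  then show ?case using chain.glue[of G n S s u T t] by simp
next
  case (glue m T u v W t)
  have uT: "u \<in> T" "u \<noteq> v" "v \<in> T" using chain_ends[OF glue.hyps(1)] by auto
  have ST: "S \<inter> T = {u}" using glue.prems(2) uT by blast
  have c: "chain G (n + m) (S \<union> T) s v"
    by (rule glue.IH[OF glue.prems(1) ST]) (use glue.prems(3) in blast)
  have u_W: "u \<notin> W" using glue.hyps(4) uT by blast
  have vW: "v \<in> W" using glue.hyps(4) by blast
  have "(S \<union> T) \<inter> W = {v}" using glue.prems(2) glue.hyps(4) u_W by blast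
  moreover have "{a, b} \<notin> edges G" if "a \<in> (S \<union> T) - {v}" "b \<in> W - {v}" for a b
  proof (cases "a \<in> T")
    case True then show ?thesis using glue.hyps(5)[of a b] that by blast
  next
    case False
    then have "a \<in> S - {u}" using that uT by blast
    moreover have "b \<in> (T \<union> W) - {u}" using that u_W by blast
    ultimately show ?thesis using glue.prems(3) by blast
  qed
  ultimately have "chain G (Suc (n + m)) ((S \<union> T) \<union> W) s t"
    using chain.glue[OF c glue.hyps(2,3)] by blast
  then show ?case by (simp add: Un_assoc)
qed

text \<open>A member of \<open>ladder_chain r\<close> has exactly \<open>r\<close> blocks; a longer
  chain is cut down to an initial segment.\<close>

lemma chain_truncate:
  "chain G n S s t \<Longrightarrow> 0 < k \<Longrightarrow> k \<le> n \<Longrightarrow> \<exists>S' t'. chain G k S' s t'"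
proof (induction rule: chain.induct)
  case (single S s t)
  then have "k = Suc 0" by simp
  then show ?case using chain.single[OF single(1,2)] by blast
next
  case (glue n S s u T t)
  show ?case
  proof (cases "k = Suc n")
    case True
    then show ?thesis using chain.glue[OF glue.hyps] by blast
  next
    case False
    then show ?thesis using glue by simp
  qed
qed

lemma chain_path: "chain G n S s t \<Longrightarrow> \<exists>xs. is_path G s xs t \<and> set xs \<subseteq> S"
proof (induction rule: chain.induct)
  case (single S s t)
  obtain P where "is_path (induced G S) s P t" by (rule super_clean_path[OF single(2)])
  then show ?case using is_path_induced[OF single(1)] by blast
next
  case (glue n S s u T t)
  obtain P where "is_path (induced G T) u P t" by (rule super_clean_path[OF glue(3)])
  then have P: "is_path G u P t" "set P \<subseteq> T" using is_path_induced[OF glue(2)] by auto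
  obtain xs where xs: "is_path G s xs u" "set xs \<subseteq> S" using glue by blast
  obtain zs where "is_path G s zs t" "set zs \<subseteq> set xs \<union> set P" by (rule is_path_trans[OF xs(1)
      P(1)])
  then show ?case using xs P by blast
qed

lemma chain_card:
  assumes "finite (verts G)"
    and "\<And>T. T \<subseteq> verts G \<Longrightarrow> super_clean_pinched_ladder (induced G T) \<Longrightarrow> card T \<le> r"
  shows "chain G n S s t \<Longrightarrow> card S \<le> n * r"
proof (induction rule: chain.induct)
  case (single S s t)
  then show ?case using assms(2)[of S] unfolding super_clean_pinched_ladder_def by auto
next
  case (glue n S s u T t)
  have "card T \<le> r" using assms(2)[of T] glue unfolding super_clean_pinched_ladder_def by blast
  moreover have "card (S \<union> T) \<le> card S + card T" by (rule card_Un_le)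
  ultimately show ?case using glue by simp
qed

lemma ladder_chain_of_chain:
  assumes G: "simple_graph G"
  shows "chain G n S s t \<Longrightarrow> \<exists>L u. inj_on L {1..n} \<and> {B. is_block (induced G S) B} = L ` {1..n} \<and>
    inj_on u {1..n + 1} \<and> u (n + 1) = t \<and> u ` {1..n + 1} \<subseteq> S \<and>
    (\<forall>i \<in> {1..n}. super_clean_between (L i) (u i) (u (i + 1)))"
proof (induction rule: chain.induct)
  case (single S s t)
  have sub: "subgraph (induced G S) (induced G S)"
    using simple_graph_induced[OF G single(1)] unfolding subgraph_def by simp
  have ns: "nonseparable (induced G S)" using super_clean_nonseparable[OF single(2)] .
  have "{B. is_block (induced G S) B} = {induced G S}"
  proof (intro equalityI subsetI)
    fix B assume "B \<in> {B. is_block (induced G S) B}"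
    then show "B \<in> {induced G S}" using sub ns unfolding is_block_def by blast
  next
    fix B assume "B \<in> {induced G S}"
    then show "B \<in> {B. is_block (induced G S) B}"
      using sub ns subgraph_induced_antisym[of _ G S] unfolding is_block_def by blast
  qed
  moreover have "s \<noteq> t" "s \<in> S" "t \<in> S" using super_clean_ends[OF single(2)] by auto
  ultimately show ?case
    using single(2)
    by (intro exI[of _ "\<lambda>_. induced G S"] exI[of _ "\<lambda>i. if i = 1 then s else t"])
      (auto simp: inj_on_def numeral_2_eq_2 atLeastAtMostSuc_conv)
next
  case (glue n S s u T t)
  obtain L w where L: "inj_on L {1..n}" "{B. is_block (induced G S) B} = L ` {1..n}"
    and w: "inj_on w {1..n + 1}" "w (n + 1) = u" "w ` {1..n + 1} \<subseteq> S"
    and Lw: "\<forall>i \<in> {1..n}. super_clean_between (L i) (w i) (w (i + 1))"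
    using glue.IH by blast
  have ut: "u \<noteq> t" "t \<in> T" using super_clean_ends[OF glue.hyps(3)] by auto
  then have tS: "t \<notin> S" using glue.hyps(4) by auto
  have SV: "S \<subseteq> verts G" using chain_ends[OF glue.hyps(1)] by blast
  \<comment> \<open>Each block of the shorter chain is a ladder and contains its two distinct ends,
    so it is not confined to one vertex, as \<open>blocks_glue\<close> demands.\<close>
  have two: "\<not> verts B \<subseteq> {v}" if B: "is_block (induced G S) B" for B v
  proof -
    obtain i where "i \<in> {1..n}" "B = L i" using B L(2) by blast
    then have "super_clean_between B (w i) (w (i + 1))" using Lw by blast
    then show ?thesis using super_clean_ends[of B "w i" "w (i + 1)"] by auto
  qed
  have blocks: "{B. is_block (induced G (S \<union> T)) B} = insert (induced G T) (L ` {1..n})"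
    unfolding L(2)[symmetric]
  proof (rule blocks_glue[OF G _ glue.hyps(4,5)])
    show "S \<union> T \<subseteq> verts G" using SV glue.hyps(2) by blast
    show "nonseparable (induced G T)" by (rule super_clean_nonseparable[OF glue.hyps(3)])
    show "\<not> T \<subseteq> {u}" using ut by blast
  qed (use two in auto)
  \<comment> \<open>The new end \<open>t\<close> lies in \<open>T\<close> but outside
    \<open>S\<close>, so the new ladder differs from all blocks found so far.\<close>
  have new: "induced G T \<notin> L ` {1..n}"
  proof
    assume "induced G T \<in> L ` {1..n}"
    then have "is_block (induced G S) (induced G T)" using L(2) by blast
    then have "T \<subseteq> S" unfolding is_block_def subgraph_def by simp
    then show False using ut tS by blast
  qed
  let ?L = "L(Suc n := induced G T)" and ?w = "w(Suc (Suc n) := t)"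
  have eqL: "?L ` {1..n} = L ` {1..n}" by (rule image_cong) auto
  have eqw: "?w ` {1..n + 1} = w ` {1..n + 1}" by (rule image_cong) auto
  have iv: "{1..Suc n} = insert (Suc n) {1..n}" "{1..Suc n + 1} = insert (Suc (Suc n)) {1..n + 1}"
      by auto
  have "inj_on ?L {1..Suc n}"
  proof -
    have "inj_on ?L {1..n}" using L(1) inj_on_cong[of "{1..n}" ?L L] by simp
    moreover have "{1..n} - {Suc n} = {1..n}" by auto
    ultimately show ?thesis unfolding iv inj_on_insert using new eqL by (simp del: fun_upd_apply
        add: fun_upd_same)
  qed
  moreover have "inj_on ?w {1..Suc n + 1}"
  proof -
    have "inj_on ?w {1..n + 1}" using w(1) inj_on_cong[of "{1..n + 1}" ?w w] by simp
    moreover have "{1..n + 1} - {Suc (Suc n)} = {1..n + 1}" by auto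
    moreover have "t \<notin> w ` {1..n + 1}" using w(3) tS by blast
    ultimately show ?thesis unfolding iv inj_on_insert using eqw by (simp del: fun_upd_apply add:
        fun_upd_same)
  qed
  moreover have "{B. is_block (induced G (S \<union> T)) B} = ?L ` {1..Suc n}"
    unfolding blocks iv using eqL by auto
  moreover have "?w ` {1..Suc n + 1} \<subseteq> S \<union> T" unfolding iv using eqw w(3) ut by auto
  moreover have "\<forall>i \<in> {1..Suc n}. super_clean_between (?L i) (?w i) (?w (i + 1))"
    using Lw glue.hyps(3) w(2) by auto
  moreover have "?w (Suc n + 1) = t" by simp
  ultimately show ?case by blast
qed

lemma contains_ladder_chain:
  assumes G: "simple_graph G" and c: "chain G n S s t"
  shows "contains_induced G {H. ladder_chain n H}"
proof (rule contains_inducedI)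
  show S: "S \<subseteq> verts G" using chain_ends[OF c] by blast
  show "induced G S \<in> {H. ladder_chain n H}"
    using ladder_chain_of_chain[OF G c] simple_graph_induced[OF G S]
    unfolding ladder_chain_def by blast
qed

section \<open>From bridgeless vertex sets to chains\<close>

lemma is_path_length_3:
  assumes p: "is_path G s xs t" and "s \<noteq> t" "{s, t} \<notin> path_edges xs"
  shows "3 \<le> length xs"
proof (rule ccontr)
  assume l: "\<not> 3 \<le> length xs"
  have e: "xs \<noteq> []" "hd xs = s" "last xs = t" using is_path_ends[OF p] by auto
  obtain ys where ys: "xs = s # ys" using e by (cases xs) auto
  have "ys \<noteq> []" using e ys assms(2) by auto
  then obtain y zs where zs: "ys = y # zs" by (cases ys) auto
  have "zs = []" using l unfolding ys zs by (cases zs) auto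
  then have "xs = [s, t]" using e(3) unfolding ys zs by simp
  then show False using assms(3) by simp
qed

text \<open>Induction on the size of \<open>S\<close>. A smaller bridgeless set with the same ends
  replaces \<open>S\<close>. In a minimal \<open>S\<close> either some vertex separates the ends,
  and the chains of the two sides are joined there, or none does, and \<open>S\<close> contains a
  single ladder from \<open>s\<close> to \<open>t\<close>.\<close>

lemma chain_exists:
  assumes G: "simple_graph G"
  shows "S \<subseteq> verts G \<Longrightarrow> s \<noteq> t \<Longrightarrow> bridgeless_between G S s t \<Longrightarrow>
    \<exists>n S'. S' \<subseteq> S \<and> chain G n S' s t"
proof (induction "card S" arbitrary: S s t rule: less_induct)
  case less
  note SV = less.prems(1) and st = less.prems(2) and br = less.prems(3)
  have fin: "finite S" using SV G finite_subset unfolding simple_graph_def by blast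
  show ?case
  proof (cases "\<exists>S'. S' \<subset> S \<and> bridgeless_between G S' s t")
    case True
    then obtain S' where S': "S' \<subset> S" "bridgeless_between G S' s t" by blast
    then have "card S' < card S" using fin psubset_card_mono by blast
    then show ?thesis using less.hyps[of S' s t] S' SV st by blast
  next
    case minimal: False
    show ?thesis
    proof (cases "\<exists>x\<in>S - {s, t}. \<not> (\<exists>xs. is_path G s xs t \<and> set xs \<subseteq> S - {x})")
      case True
      then obtain x where x: "x \<in> S" "x \<noteq> s" "x \<noteq> t"
        and sep: "\<And>xs. is_path G s xs t \<Longrightarrow> set xs \<subseteq> S \<Longrightarrow> x \<in> set xs" by blast
      \<comment> \<open>The side of \<open>s\<close> is what can be reached inside \<open>S\<close>
        without \<open>x\<close>; everything else goes to the side of \<open>t\<close>, and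
        \<open>x\<close> belongs to both.\<close>
      define A where "A = insert x {y. \<exists>xs. is_path G s xs y \<and> set xs \<subseteq> S - {x}}"
      define B where "B = insert x (S - A)"
      have AS: "A \<subseteq> S"
      proof
        fix y assume "y \<in> A"
        then consider "y = x" | xs where "is_path G s xs y" "set xs \<subseteq> S - {x}"
          unfolding A_def by blast
        then show "y \<in> S" using x is_path_ends[of G s] by cases blast+
      qed
      have BS: "B \<subseteq> S" using x unfolding B_def by blast
      have AB: "A \<inter> B = {x}" unfolding A_def B_def by blast
      have tA: "t \<notin> A" using sep x unfolding A_def by blast
      obtain xs0 where xs0: "is_path G s xs0 t" "set xs0 \<subseteq> S"
        using br unfolding bridgeless_between_def by blast
      have sS: "s \<in> S" "t \<in> S" using is_path_ends[OF xs0(1)] xs0(2) by auto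
      have sA: "s \<in> A" unfolding A_def using sS x SV by (auto intro!: exI[of _ "[s]"])
      have noedge: "{a, b} \<notin> edges G" if ab: "a \<in> A - {x}" "b \<in> B - {x}" for a b
      proof
        assume e: "{a, b} \<in> edges G"
        obtain xs where xs: "is_path G s xs a" "set xs \<subseteq> S - {x}" using ab unfolding A_def by blast
        have b: "b \<in> S" "b \<notin> A" "b \<noteq> x" using ab unfolding B_def by auto
        have pab: "is_path G a [a, b] b"
          using e edges_simple[OF G e] by (simp add: is_path_Cons)
        obtain zs where "is_path G s zs b" "set zs \<subseteq> set xs \<union> set [a, b]"
          by (rule is_path_trans[OF xs(1) pab])
        moreover have "set xs \<union> set [a, b] \<subseteq> S - {x}" using xs(2) is_path_ends[OF xs(1)] b by auto
        ultimately have "b \<in> A" unfolding A_def by blast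
        then show False using b by simp
      qed
      \<comment> \<open>For each \<open>e\<close>, a path in \<open>S\<close> that avoids
        \<open>e\<close> must pass through \<open>x\<close>, and its two halves stay on their sides.
        Hence both sides are again bridgeless.\<close>
      have split: "\<exists>ys zs. is_path G s ys x \<and> set ys \<subseteq> A \<and> e \<notin> path_edges ys \<and>
          is_path G x zs t \<and> set zs \<subseteq> B \<and> e \<notin> path_edges zs" for e
      proof -
        obtain xs where xs: "is_path G s xs t" "set xs \<subseteq> S" "e \<notin> path_edges xs"
          using br unfolding bridgeless_between_def by blast
        obtain ys zs where yz: "xs = ys @ x # zs" using split_list[OF sep[OF xs(1,2)]] by blast
        have d: "distinct (ys @ x # zs)" using is_path_ends[OF xs(1)] yz by simp
        have ys: "is_path G s (ys @ [x]) x" using is_path_prefix[OF xs(1)[unfolded yz]] .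
        have zs: "is_path G x (x # zs) t" using is_path_suffix[OF xs(1)[unfolded yz]] .
        have "y \<in> A" if y: "y \<in> set ys" for y
        proof -
          obtain y1 y2 where "ys = y1 @ y # y2" using split_list[OF y] by blast
          then have yp: "is_path G s (y1 @ y # (y2 @ [x])) x" and sub: "set (y1 @ [y]) \<subseteq> S - {x}"
            using ys d xs(2) yz by auto
          have "is_path G s (y1 @ [y]) y" by (rule is_path_prefix[OF yp])
          then show ?thesis using sub unfolding A_def by blast
        qed
        \<comment> \<open>If the second half returned to a vertex \<open>z\<close> reachable without
          \<open>x\<close>, then going to \<open>z\<close> that way and on to \<open>t\<close> would
          give a path avoiding \<open>x\<close>.\<close>
        moreover have "z \<in> B" if z: "z \<in> set zs" for z
        proof (rule ccontr)
          assume "z \<notin> B"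
          then have "z \<in> A" "z \<noteq> x" using z xs(2) yz d unfolding B_def by auto
          then obtain p where p: "is_path G s p z" "set p \<subseteq> S - {x}" unfolding A_def by blast
          obtain z1 z2 where z12: "zs = z1 @ z # z2" using split_list[OF z] by blast
          then have "is_path G x ((x # z1) @ z # z2) t" using zs by simp
          then have q: "is_path G z (z # z2) t" by (rule is_path_suffix)
          obtain w where w: "is_path G s w t" "set w \<subseteq> set p \<union> set (z # z2)"
            by (rule is_path_trans[OF p(1) q])
          moreover have "set (z # z2) \<subseteq> S - {x}" using xs(2) yz z12 d by auto
          ultimately have "set w \<subseteq> S - {x}" using p(2) by blast
          then show False using sep[OF w(1)] by blast
        qed
        moreover have "path_edges (ys @ [x]) \<subseteq> path_edges xs" "path_edges (x # zs) \<subseteq> path_edges xs"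
          unfolding yz by (auto simp: path_edges_append path_edges_Cons)
        ultimately show ?thesis
          using ys zs xs(3)
          by (intro exI[of _ "ys @ [x]"] exI[of _ "x # zs"]) (auto simp: A_def B_def)
      qed
      have brA: "bridgeless_between G A s x" unfolding bridgeless_between_def using split by blast
      have brB: "bridgeless_between G B x t" unfolding bridgeless_between_def using split by blast
      have "A \<subset> S" "B \<subset> S" using AS BS tA sS sA AB x by auto
      then have "card A < card S" "card B < card S" using fin psubset_card_mono by auto
      then obtain n A' m B' where A': "A' \<subseteq> A" "chain G n A' s x" and B': "B' \<subseteq> B" "chain G m B' x
          t"
        using less.hyps[of A s x] less.hyps[of B x t] AS BS SV x brA brB by blast
      have "x \<in> A'" "x \<in> B'" using chain_ends[OF A'(2)] chain_ends[OF B'(2)] by auto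
      then have "A' \<inter> B' = {x}" using A'(1) B'(1) AB by blast
      then have "chain G (n + m) (A' \<union> B') s t"
      proof (rule chain_append[OF B'(2) A'(2)])
        fix a b assume "a \<in> A' - {x}" "b \<in> B' - {x}"
        then show "{a, b} \<notin> edges G" using noedge[of a b] A'(1) B'(1) by blast
      qed
      moreover have "A' \<union> B' \<subseteq> S" using A'(1) B'(1) AS BS by blast
      ultimately show ?thesis by (intro exI conjI)
    next
      case False
      show ?thesis
      proof (cases "{s, t} \<in> edges G")
        case True
        \<comment> \<open>Without the edge \<open>st\<close> there is still a path; a shortest one
          in the remaining graph has no chord except \<open>st\<close>, and together with
          \<open>st\<close> it forms an induced cycle.\<close>
        let ?H = "del_edges G {{s, t}}"
        obtain xs where xs: "is_path G s xs t" "set xs \<subseteq> S" "{s, t} \<notin> path_edges xs"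
          using br unfolding bridgeless_between_def by blast
        then have "is_path ?H s xs t" by (simp add: is_path_del_edges)
        then obtain Q where Q: "is_induced_path ?H s Q t" "set Q \<subseteq> set xs"
          using induced_path_exists[OF simple_graph_del_edges[OF G]] by metis
        then have Qp: "is_path G s Q t" "{s, t} \<notin> path_edges Q"
          unfolding is_induced_path_def is_path_del_edges by auto
        have "edges (induced ?H (set Q)) = path_edges Q"
          using Q(1) unfolding is_induced_path_def path_graph_def by simp
        then have E: "edges (induced G (set Q)) = insert {s, t} (path_edges Q)"
          using True is_path_ends[OF Qp(1)] unfolding edges_induced del_edges_def by auto
        have "3 \<le> length Q" using is_path_length_3[OF Qp(1) st Qp(2)] .
        then have "super_clean_between (induced G (set Q)) s t"
          using super_clean_cycle[OF G Qp(1) _ E] by blast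
        then have "chain G (Suc 0) (set Q) s t" by (rule chain.single[OF is_path_verts[OF Qp(1)]])
        moreover have "set Q \<subseteq> S" using Q(2) xs(2) by blast
        ultimately show ?thesis by (intro exI conjI)
      next
        case nadj: False
        have "\<exists>xs. is_path (induced G S) s xs t \<and> x \<notin> set xs"
          if x: "x \<in> verts (induced G S)" "x \<noteq> s" "x \<noteq> t" for x
        proof -
          obtain xs where "is_path G s xs t" "set xs \<subseteq> S - {x}" using False x by auto
          then show ?thesis using is_path_induced[OF SV] by blast
        qed
        moreover obtain xs0 where "is_path (induced G S) s xs0 t"
          using br is_path_induced[OF SV] unfolding bridgeless_between_def by blast
        ultimately obtain P0 Q0 where P0: "is_path (induced G S) s P0 t" and Q0: "is_path (induced
            G S) s Q0 t"
          and PQ0: "set P0 \<inter> set Q0 = {s, t}"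
          using two_disjoint_paths[of "induced G S" s t] st by metis
        have P0G: "is_path G s P0 t" "set P0 \<subseteq> S" and Q0G: "is_path G s Q0 t" "set Q0 \<subseteq> S"
          using P0 Q0 is_path_induced[OF SV] by auto
        obtain P where P: "is_induced_path G s P t" "set P \<subseteq> set P0"
          using induced_path_exists[OF G P0G(1)] by metis
        obtain Q where Q: "is_induced_path G s Q t" "set Q \<subseteq> set Q0"
          using induced_path_exists[OF G Q0G(1)] by metis
        have pP: "is_path G s P t" and pQ: "is_path G s Q t"
          using P Q unfolding is_induced_path_def by auto
        have eP: "s \<in> set P" "t \<in> set P" "s \<in> set Q" "t \<in> set Q"
          using is_path_ends[OF pP] is_path_ends[OF pQ] by auto
        have PQ: "set P \<inter> set Q = {s, t}" using PQ0 P(2) Q(2) eP by blast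
        then have "path_edges P \<inter> path_edges Q = {}" using path_edges_disjoint[OF G pP _ nadj] by
            blast
        then have "bridgeless_between G (set P \<union> set Q) s t"
          using bridgeless_between_paths[OF pP pQ] by blast
        \<comment> \<open>The shortened paths alone already span a bridgeless set, so by minimality
          they exhaust \<open>S\<close>. Thus the rerouting lemmas apply to the whole of
          \<open>S\<close>.\<close>
        then have "\<not> set P \<union> set Q \<subset> S" using minimal by blast
        moreover have "set P \<union> set Q \<subseteq> S" using P(2) Q(2) P0G(2) Q0G(2) by blast
        ultimately have S: "S = set P \<union> set Q" by blast
        have min: "\<not> bridgeless_between G S' s t" if "S' \<subset> set P \<union> set Q" for S'
          using minimal that unfolding S by blast
        let ?L = "induced G S"
        have "set P \<subseteq> S" "set Q \<subseteq> S" using S by auto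
        then have indP: "is_induced_path ?L s P t" and indQ: "is_induced_path ?L s Q t"
          using P(1) Q(1) is_path_induced[OF SV]
          unfolding is_induced_path_def by (auto simp: induced_induced)
        have "rail P \<noteq> []"
        proof -
          have "3 \<le> length P" using is_path_length_3[OF pP st] nadj is_path_path_edges[OF pP] by
              blast
          then have "0 < length (rail P)" unfolding rail_def by simp
          then show ?thesis by simp
        qed
        then have "pinched_ladder ?L P Q s t"
          unfolding pinched_ladder_def
          using simple_graph_induced[OF G SV] st indP indQ PQ S unfolding is_induced_path_def by
              simp
        moreover have "trivial_cross i j k l" if "cross ?L P Q i j k l" for i j k l
          by (rule minimal_no_bad_cross[OF G pP pQ PQ nadj min that[unfolded S]])
        moreover have "is_complete 3 F" if "embedded_fan ?L P Q F" for F
          using that unfolding embedded_fan_def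
        proof
          assume "\<exists>u\<in>set (rail P). fan_on ?L u (rail Q) F"
          then obtain u where u: "u \<in> set (rail P)" "fan_on (induced G (set P \<union> set Q)) u (rail Q)
              F"
            unfolding S by blast
          show ?thesis by (rule minimal_no_bad_fan[OF G pP pQ PQ nadj min u])
        next
          assume "\<exists>u\<in>set (rail Q). fan_on ?L u (rail P) F"
          then obtain u where u: "u \<in> set (rail Q)" "fan_on (induced G (set Q \<union> set P)) u (rail P)
              F"
            unfolding S Un_commute[of "set P"] by blast
          have QP: "set Q \<inter> set P = {s, t}" using PQ by blast
          have "\<not> bridgeless_between G S' s t" if "S' \<subset> set Q \<union> set P" for S'
            using min[of S'] that by (simp add: Un_commute)
          then show ?thesis by (rule minimal_no_bad_fan[OF G pQ pP QP nadj _ u])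
        qed
        ultimately have "super_clean_between ?L s t" unfolding super_clean_between_def by blast
        then have "chain G (Suc 0) S s t" by (rule chain.single[OF SV])
        with order_refl[of S] show ?thesis by (intro exI conjI)
      qed
    qed
  qed
qed

lemma bridgeless_between_verts:
  assumes "k_edge_connected 2 G" "s \<in> verts G" "t \<in> verts G"
  shows "bridgeless_between G (verts G) s t"
  unfolding bridgeless_between_def
proof
  fix e
  \<comment> \<open>The set \<open>e\<close> may fail to be an edge, whereas edge connectivity
    speaks of sets of edges of \<open>G\<close>.\<close>
  let ?F = "{e} \<inter> edges G"
  have "card ?F < 2" using card_mono[of "{e}" ?F] by simp
  then have "graph_connected (del_edges G ?F)"
    using assms(1) unfolding k_edge_connected_def by blast
  then obtain xs where "is_path (del_edges G ?F) s xs t"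
    using assms(2,3) unfolding graph_connected_def del_edges_def by auto
  then have xs: "is_path G s xs t" "path_edges xs \<inter> ?F = {}" by (auto simp: is_path_del_edges)
  then have "e \<notin> path_edges xs" using is_path_path_edges[OF xs(1)] by blast
  then show "\<exists>xs. is_path G s xs t \<and> set xs \<subseteq> verts G \<and> e \<notin> path_edges xs"
    using xs(1) is_path_verts[OF xs(1)] by blast
qed

text \<open>Excluding chains of \<open>r\<close> ladders leaves fewer than \<open>r\<close> of them,
  and excluding large ladders bounds each by \<open>r\<close> vertices; a path inside the chain
  therefore has at most \<open>r * r\<close> vertices.\<close>

lemma short_paths:
  assumes G: "simple_graph G" "k_edge_connected 2 G" and r: "1 \<le> r"
    and no_ladder: "\<not> contains_induced G {L. super_clean_pinched_ladder L \<and> card (verts L) \<ge> r}"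
    and no_chain: "\<not> contains_induced G {H. ladder_chain r H}"
    and st: "s \<in> verts G" "t \<in> verts G"
  shows "\<exists>xs. is_path G s xs t \<and> length xs \<le> r * r"
proof (cases "s = t")
  case True
  have "1 * 1 \<le> r * r" using mult_le_mono[OF r r] .
  then show ?thesis using True st by (intro exI[of _ "[s]"]) auto
next
  case False
  obtain n S where c: "chain G n S s t"
    using chain_exists[OF G(1) order_refl False bridgeless_between_verts[OF G(2) st]] by blast
  have S: "S \<subseteq> verts G" using chain_ends[OF c] by blast
  have finV: "finite (verts G)" using G(1) unfolding simple_graph_def by blast
  have "n < r"
  proof (rule ccontr)
    assume "\<not> n < r"
    then obtain S' t' where "chain G r S' s t'" using chain_truncate[OF c, of r] r by auto
    then show False using contains_ladder_chain[OF G(1)] no_chain by blast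
  qed
  have "card T \<le> r" if T: "T \<subseteq> verts G" "super_clean_pinched_ladder (induced G T)" for T
  proof (rule ccontr)
    assume "\<not> card T \<le> r"
    then have "induced G T \<in> {L. super_clean_pinched_ladder L \<and> card (verts L) \<ge> r}"
      using T(2) by simp
    from contains_inducedI[OF T(1) this] show False using no_ladder by simp
  qed
  then have "card S \<le> n * r" by (rule chain_card[OF finV _ c])
  also have "n * r \<le> r * r" using \<open>n < r\<close> by simp
  finally have cS: "card S \<le> r * r" .
  obtain xs where xs: "is_path G s xs t" "set xs \<subseteq> S" using chain_path[OF c] by blast
  have "length xs = card (set xs)" using is_path_ends[OF xs(1)] distinct_card by metis
  also have "\<dots> \<le> card S" using xs(2) S finV by (meson card_mono finite_subset)
  finally show ?thesis using xs(1) cS by auto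
qed

section \<open>Many paths meeting in one vertex\<close>

text \<open>A maximal family of paths to \<open>root\<close> that meet only there is either large, or some vertex of
  its union lies on many of the given paths, which then reach that vertex in fewer steps.\<close>

lemma many_paths_to_vertex:
  "\<exists>M. \<forall>(H :: 'a graph) X root. finite X \<longrightarrow> M \<le> card X \<longrightarrow>
     (\<forall>x\<in>X. \<exists>xs. is_path H x xs root \<and> length xs \<le> D) \<longrightarrow>
     (\<exists>w Y p. Y \<subseteq> X \<and> card Y = k \<and> (\<forall>y\<in>Y. is_path H y (p y) w \<and> length (p y) \<le> D) \<and>
        (\<forall>y\<in>Y. \<forall>y'\<in>Y. y \<noteq> y' \<longrightarrow> set (p y) \<inter> set (p y') = {w}))"
    (is "\<exists>M. \<forall>H X root. _ \<longrightarrow> _ \<longrightarrow> ?reach D H X root \<longrightarrow> ?fam D H X")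
proof (induction D)
  case 0
  show ?case
  \<comment> \<open>Every path has a vertex, so the bound 0 cannot hold for any element of
    \<open>X\<close>, and \<open>1 \<le> card X\<close> provides one.\<close>
  proof (intro exI[of _ 1] allI impI)
    fix H :: "'a graph" and X root
    assume "1 \<le> card X" and reach: "?reach 0 H X root"
    then have "X \<noteq> {}" by auto
    then obtain x where "x \<in> X" by blast
    then obtain xs where xs: "is_path H x xs root" "length xs \<le> 0" using reach by blast
    have "xs \<noteq> []" using is_path_ends[OF xs(1)] by blast
    then have False using xs(2) by simp
    then show "?fam 0 H X" ..
  qed
next
  case (Suc D)
  then obtain M where M: "\<forall>(H :: 'a graph) X root. finite X \<longrightarrow> M \<le> card X \<longrightarrow>
    ?reach D H X root \<longrightarrow> ?fam D H X" ..
  have IH: "?fam D H X" if "finite X" "M \<le> card X" "?reach D H X root" for H :: "'a graph" and X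
      root
    by (rule M[THEN spec, THEN spec, THEN spec, THEN mp, THEN mp, THEN mp]) (fact that)+
  show ?case
  \<comment> \<open>A family of fewer than \<open>k\<close> paths has at most
    \<open>k * Suc D\<close> vertices besides the root. If none of them lay on \<open>M\<close> of
    the given paths, there would be at most \<open>k * Suc D * M\<close> starting vertices other
    than the root. One \<open>Suc\<close> accounts for the root, the other makes the contradiction
    strict.\<close>
  proof (intro exI[of _ "Suc (Suc (k * Suc D * M))"] allI impI)
    fix H :: "'a graph" and X root
    assume fin: "finite X" and big: "Suc (Suc (k * Suc D * M)) \<le> card X" and "?reach (Suc D) H X
        root"
    then obtain p where p: "\<And>x. x \<in> X \<Longrightarrow> is_path H x (p x) root" "\<And>x. x \<in> X \<Longrightarrow> length (p x) \<le> Suc D"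
      by metis
    have ends: "x \<in> set (p x)" "root \<in> set (p x)" "p x \<noteq> []" "last (p x) = root" if "x \<in> X" for x
      using is_path_ends[OF p(1)[OF that]] by auto
    define good where
      "good Y \<longleftrightarrow> Y \<subseteq> X \<and> (\<forall>y\<in>Y. \<forall>y'\<in>Y. y \<noteq> y' \<longrightarrow> set (p y) \<inter> set (p y') = {root})" for Y
    have "finite {Y. good Y}" using fin unfolding good_def by (auto intro: finite_subset[of _ "Pow
        X"])
    moreover have "good {}" unfolding good_def by simp
    ultimately obtain Y where Y: "good Y" and max: "\<And>Z. good Z \<Longrightarrow> Y \<subseteq> Z \<Longrightarrow> Z = Y"
      using finite_has_maximal[of "{Y. good Y}"] by blast
    have YX: "Y \<subseteq> X" using Y unfolding good_def by blast
    show "?fam (Suc D) H X"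
    proof (cases "k \<le> card Y")
      case True
      then obtain Z where Z: "Z \<subseteq> Y" "card Z = k" using obtain_subset_with_card_n by metis
      then have "good Z" using Y unfolding good_def by blast
      then show ?thesis using Z(2) p unfolding good_def by (intro exI[of _ root] exI[of _ Z]
          exI[of _ p]) auto
    next
      case False
      define U where "U = (\<Union>y\<in>Y. set (p y)) - {root}"
      have finY: "finite Y" using YX fin finite_subset by blast
      have finU: "finite U" unfolding U_def using finY by simp
      have "card U \<le> card (\<Union>y\<in>Y. set (p y))" unfolding U_def by (rule card_mono) (use finY in auto)
      also have "\<dots> \<le> (\<Sum>y\<in>Y. card (set (p y)))" by (rule card_UN_le[OF finY])
      also have "\<dots> \<le> (\<Sum>y\<in>Y. Suc D)"
        by (rule sum_mono) (meson YX card_length le_trans p(2) subsetD)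
      also have "\<dots> = card Y * Suc D" by simp
      also have "\<dots> \<le> k * Suc D" by (rule mult_le_mono1) (use False in simp)
      finally have cU: "card U \<le> k * Suc D" .
      \<comment> \<open>A path that meets the family only in the root could be added to it; a path
        that belongs to the family meets \<open>U\<close> in its own start.\<close>
      have hit: "\<exists>u\<in>U. u \<in> set (p x)" if x: "x \<in> X - {root}" for x
      proof (cases "x \<in> Y")
        case True
        then show ?thesis using ends[of x] x unfolding U_def by blast
      next
        case xY: False
        have "\<not> good (insert x Y)" using max[of "insert x Y"] xY by blast
        then obtain y where y: "y \<in> Y" "set (p x) \<inter> set (p y) \<noteq> {root}"
          using Y x unfolding good_def by (auto simp: Int_commute)
        moreover have "root \<in> set (p x) \<inter> set (p y)" using ends x y(1) YX by blast
        ultimately obtain u where "u \<in> set (p x) \<inter> set (p y)" "u \<noteq> root" by blast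
        then show ?thesis using y(1) unfolding U_def by blast
      qed
      have "\<exists>u\<in>U. M \<le> card {x \<in> X. u \<in> set (p x)}"
      proof (rule ccontr)
        assume "\<not> ?thesis"
        then have small: "card {x \<in> X. u \<in> set (p x)} \<le> M" if "u \<in> U" for u using that by force
        have "card (X - {root}) \<le> card (\<Union>u\<in>U. {x \<in> X. u \<in> set (p x)})"
          by (rule card_mono) (use finU fin hit in auto)
        also have "\<dots> \<le> (\<Sum>u\<in>U. card {x \<in> X. u \<in> set (p x)})" by (rule card_UN_le[OF finU])
        also have "\<dots> \<le> (\<Sum>u\<in>U. M)" by (rule sum_mono) (use small in auto)
        also have "\<dots> = card U * M" by simp
        also have "\<dots> \<le> k * Suc D * M" using cU by (rule mult_le_mono1)
        finally have "card X \<le> Suc (k * Suc D * M)"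
          using fin by (cases "root \<in> X") auto
        then show False using big by simp
      qed
      then obtain u where u: "u \<in> U" "M \<le> card {x \<in> X. u \<in> set (p x)}" by blast
      have uroot: "u \<noteq> root" using u(1) unfolding U_def by blast
      have "\<exists>xs. is_path H x xs u \<and> length xs \<le> D" if x: "x \<in> {x \<in> X. u \<in> set (p x)}" for x
      proof -
        have xX: "x \<in> X" and ux: "u \<in> set (p x)" using x by auto
        obtain a b where ab: "p x = a @ u # b" using split_list[OF ux] by blast
        \<comment> \<open>As \<open>u\<close> is not the root, cutting the path at \<open>u\<close>
          loses at least one vertex. So \<open>u\<close> can act as the new root with the bound
          \<open>D\<close>.\<close>
        have "b \<noteq> []" using ends(4)[OF xX] uroot ab by auto
        then have "length (a @ [u]) \<le> D" using p(2)[OF xX] unfolding ab by (cases b) auto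
        then show ?thesis using is_path_prefix[OF p(1)[OF xX, unfolded ab]] by blast
      qed
      then have "\<forall>x\<in>{x \<in> X. u \<in> set (p x)}. \<exists>xs. is_path H x xs u \<and> length xs \<le> D" ..
      with finite_subset[OF _ fin] have "?fam D H {x \<in> X. u \<in> set (p x)}"
        by (intro IH[OF _ u(2)]) simp_all
      then obtain w Z q where "Z \<subseteq> {x \<in> X. u \<in> set (p x)}" "card Z = k"
        "\<forall>y\<in>Z. is_path H y (q y) w \<and> length (q y) \<le> D"
        "\<forall>y\<in>Z. \<forall>y'\<in>Z. y \<noteq> y' \<longrightarrow> set (q y) \<inter> set (q y') = {w}" by blast
      then show ?thesis by (intro exI[of _ w] exI[of _ Z] exI[of _ q]) auto
    qed
  qed
qed

section \<open>Flowers\<close>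

text \<open>Without edges between different petals, every edge of the union lies in one petal.
  Edge-disjointness comes for free: a common edge would have both ends equal to
  \<open>v\<close>.\<close>

lemma contains_flower:
  assumes G: "simple_graph G"
    and C: "\<And>i. i < r \<Longrightarrow> is_induced_cycle G (C i) \<and> v \<in> set (C i)"
    and dis: "\<And>i j. i < r \<Longrightarrow> j < r \<Longrightarrow> i \<noteq> j \<Longrightarrow> set (C i) \<inter> set (C j) = {v}"
    and ne: "\<And>i j a b. i < r \<Longrightarrow> j < r \<Longrightarrow> i \<noteq> j \<Longrightarrow> a \<in> set (C i) - {v} \<Longrightarrow> b \<in> set (C j) - {v} \<Longrightarrow>
      {a, b} \<notin> edges G"
  shows "contains_induced G {H. is_flower r H}"
proof -
  let ?V = "\<Union>i<r. set (C i)"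
  let ?H = "induced G ?V"
  have V: "?V \<subseteq> verts G" using C unfolding is_induced_cycle_def is_cycle_def by blast
  have E: "edges (induced G (set (C i))) = cycle_edges (C i)" if "i < r" for i
    using C[OF that] unfolding is_induced_cycle_def by blast
  have "is_induced_cycle ?H (C i)" if i: "i < r" for i
  proof -
    have sub: "set (C i) \<subseteq> ?V" using i by blast
    have "cycle_edges (C i) \<subseteq> edges ?H" using sub unfolding E[OF i, symmetric] by (auto simp:
        edges_induced)
    then show ?thesis
      using C[OF i] sub unfolding is_induced_cycle_def is_cycle_def by (simp add: induced_induced)
  qed
  moreover have "cycle_edges (C i) \<inter> cycle_edges (C j) = {}" if ij: "i < r" "j < r" "i \<noteq> j" for i j
  proof (rule ccontr)
    assume "cycle_edges (C i) \<inter> cycle_edges (C j) \<noteq> {}"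
    then obtain e where "e \<in> cycle_edges (C i)" "e \<in> cycle_edges (C j)" by blast
    then have e: "e \<in> edges G" "e \<subseteq> set (C i)" "e \<subseteq> set (C j)"
      unfolding E[OF ij(1), symmetric] E[OF ij(2), symmetric] by (auto simp: edges_induced)
    obtain x y where "e = {x, y}" "x \<noteq> y" by (rule edge_simpleE[OF G e(1)])
    moreover have "e \<subseteq> {v}" using e dis[OF ij] by blast
    ultimately show False by simp
  qed
  moreover have "edges ?H = (\<Union>i<r. cycle_edges (C i))"
  proof
    show "edges ?H \<subseteq> (\<Union>i<r. cycle_edges (C i))"
    proof
      fix e assume "e \<in> edges ?H"
      then have e: "e \<in> edges G" "e \<subseteq> ?V" by (auto simp: edges_induced)
      obtain x y where xy: "e = {x, y}" by (rule edge_simpleE[OF G e(1)])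
      then obtain i j where ij: "i < r" "x \<in> set (C i)" "j < r" "y \<in> set (C j)" using e(2) by auto
      have "\<exists>i<r. e \<subseteq> set (C i)"
      proof (cases "i = j \<or> x = v \<or> y = v")
        case True
        then show ?thesis using ij C xy by auto
      next
        case False
        then show ?thesis using ne[of i j x y] ij e(1) xy by blast
      qed
      then obtain i where "i < r" "e \<in> edges (induced G (set (C i)))" using e(1) by (auto simp:
          edges_induced)
      then show "e \<in> (\<Union>i<r. cycle_edges (C i))" using E by auto
    qed
    show "(\<Union>i<r. cycle_edges (C i)) \<subseteq> edges ?H"
    proof
      fix e assume "e \<in> (\<Union>i<r. cycle_edges (C i))"
      then obtain i where "i < r" "e \<in> edges (induced G (set (C i)))" using E by auto
      then show "e \<in> edges ?H" by (auto simp: edges_induced)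
    qed
  qed
  ultimately have "is_flower r ?H"
    unfolding is_flower_def using simple_graph_induced[OF G V] C dis
    by (intro conjI exI[of _ v] exI[of _ C]) auto
  then show ?thesis by (intro contains_inducedI[OF V]) simp
qed

lemma induced_cycle_of_path:
  assumes G: "simple_graph G" and xs: "is_induced_path G x xs y" and v: "v \<notin> set xs"
    and e: "{v, x} \<in> edges G" "{v, y} \<in> edges G" and xy: "x \<noteq> y"
    and only: "\<And>z. z \<in> set xs \<Longrightarrow> {v, z} \<in> edges G \<Longrightarrow> z = x \<or> z = y"
  shows "is_induced_cycle G (v # xs)"
proof -
  have p: "is_path G x xs y" and E: "edges (induced G (set xs)) = path_edges xs"
    using xs unfolding is_induced_path_def path_graph_def by (auto simp: induced_def)
  have ends: "hd xs = x" "last xs = y" "xs \<noteq> []" "distinct xs" "x \<in> set xs" "y \<in> set xs"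
    using is_path_ends[OF p] by auto
  have c: "cycle_edges (v # xs) = insert {v, x} (insert {v, y} (path_edges xs))"
    using ends by (auto simp: cycle_edges_def path_edges_Cons insert_commute)
  have "2 \<le> length xs" using ends xy by (cases xs; cases "tl xs") auto
  then have "is_cycle G (v # xs)"
    unfolding is_cycle_def c
    using v ends e is_path_verts[OF p] is_path_path_edges[OF p] edges_simple[OF G e(1)] by auto
  moreover have "edges (induced G (set (v # xs))) = cycle_edges (v # xs)"
  proof
    show "edges (induced G (set (v # xs))) \<subseteq> cycle_edges (v # xs)"
    proof
      fix f assume "f \<in> edges (induced G (set (v # xs)))"
      then have f: "f \<in> edges G" "f \<subseteq> insert v (set xs)" by (auto simp: edges_induced)
      obtain a b where ab: "f = {a, b}" "a \<noteq> b" by (rule edge_simpleE[OF G f(1)])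
      show "f \<in> cycle_edges (v # xs)"
      proof (cases "v \<in> f")
        case True
        then obtain z where z: "f = {v, z}" "z \<noteq> v" using ab by auto
        then have "z = x \<or> z = y" using only f by auto
        then show ?thesis using z unfolding c by auto
      next
        case False
        then have "f \<in> edges (induced G (set xs))" using f by (auto simp: edges_induced)
        then show ?thesis unfolding E c by blast
      qed
    qed
    show "cycle_edges (v # xs) \<subseteq> edges (induced G (set (v # xs)))"
      unfolding c E[symmetric] using e ends by (auto simp: edges_induced)
  qed
  ultimately show ?thesis unfolding is_induced_cycle_def by blast
qed

text \<open>A chord could only come from a neighbour of \<open>v\<close> strictly between positions
  \<open>i\<close> and \<open>j\<close>, because the segment of \<open>R\<close> itself is
  induced.\<close>

lemma consecutive_cycle:
  assumes G: "simple_graph G" and R: "is_induced_path G x R y" and v: "v \<notin> set R"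
    and ij: "i < j" "j < length R" "{v, R ! i} \<in> edges G" "{v, R ! j} \<in> edges G"
    and gap: "\<And>k. i < k \<Longrightarrow> k < j \<Longrightarrow> {v, R ! k} \<notin> edges G"
  shows "is_induced_cycle G (v # drop i (take (Suc j) R))"
proof (rule induced_cycle_of_path[OF G])
  have p: "is_path G x R y" using R unfolding is_induced_path_def by blast
  have d: "distinct R" using is_path_ends[OF p] by blast
  show "is_induced_path G (R ! i) (drop i (take (Suc j) R)) (R ! j)"
    using induced_path_segment[OF R] ij by simp
  show "v \<notin> set (drop i (take (Suc j) R))" using v by (auto dest: in_set_takeD in_set_dropD)
  show "R ! i \<noteq> R ! j" using d ij by (simp add: nth_eq_iff_index_eq)
  fix z assume "z \<in> set (drop i (take (Suc j) R))" and e: "{v, z} \<in> edges G"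
  then obtain k where "k < Suc j - i" "z = R ! (i + k)" using ij by (auto simp: in_set_conv_nth)
  then show "z = R ! i \<or> z = R ! j" using gap[of "i + k"] e by (cases "k = 0"; cases "i + k = j")
      auto
qed (use ij in auto)

lemma set_segment:
  assumes "j < length R" "z \<in> set (drop i (take (Suc j) R))"
  shows "\<exists>k. i \<le> k \<and> k \<le> j \<and> z = R ! k"
proof -
  obtain m where m: "m < length (drop i (take (Suc j) R))" "z = drop i (take (Suc j) R) ! m"
    using assms(2) by (metis in_set_conv_nth)
  then have "z = R ! (i + m)" "i + m \<le> j" using assms(1) by auto
  then show ?thesis using le_add1 by blast
qed

text \<open>The neighbours of \<open>v\<close> cut \<open>R\<close> into segments, each closing to
  an induced cycle with \<open>v\<close>. A long segment is a large ladder, many segments contain a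
  flower, and few short segments make \<open>R\<close> short.\<close>

lemma path_between_neighbours_bounded:
  assumes G: "simple_graph G" and R: "is_induced_path G x R y" and v: "v \<notin> set R"
    and e: "{v, x} \<in> edges G" "{v, y} \<in> edges G"
    and no_ladder: "\<not> contains_induced G {L. super_clean_pinched_ladder L \<and> card (verts L) \<ge> r}"
    and no_flower: "\<not> contains_induced G {H. is_flower r H}"
  shows "length R \<le> Suc (3 * r * r)"
proof -
  define js where "js = filter (\<lambda>i. {v, R ! i} \<in> edges G) [0..<length R]"
  have p: "is_path G x R y" using R unfolding is_induced_path_def by blast
  have d: "distinct R" and R0: "R \<noteq> []" "R ! 0 = x" "R ! (length R - 1) = y"
    using is_path_ends[OF p] hd_conv_nth last_conv_nth by metis+
  have setjs: "set js = {i. i < length R \<and> {v, R ! i} \<in> edges G}" unfolding js_def by auto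
  have sorted: "sorted_wrt (<) js" unfolding js_def by (rule sorted_wrt_filter) simp
  have mono: "js ! a < js ! b" if "a < b" "b < length js" for a b
    using sorted_wrt_nth_less[OF sorted] that by blast
  have js: "js ! a < length R" "{v, R ! (js ! a)} \<in> edges G" if "a < length js" for a
    using nth_mem[OF that] setjs by auto
  have cyc: "is_induced_cycle G (v # drop (js ! a) (take (Suc (js ! Suc a)) R))" (is
      "is_induced_cycle G (?C a)")
    if a: "Suc a < length js" for a
  proof (rule consecutive_cycle[OF G R v])
    fix k assume k: "js ! a < k" "k < js ! Suc a"
    show "{v, R ! k} \<notin> edges G"
    proof
      assume "{v, R ! k} \<in> edges G"
      then have "k \<in> set js" using setjs k js(1)[OF a] by simp
      then obtain b where b: "b < length js" "k = js ! b" by (metis in_set_conv_nth)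
      have "b \<le> a \<or> b = Suc a \<or> Suc a < b" by linarith
      then show False using mono[of b a] mono[of "Suc a" b] k b a by (cases "b = a") auto
    qed
  qed (use js[of a] js[of "Suc a"] mono[of a "Suc a"] a in auto)
  let ?C = "\<lambda>a. v # drop (js ! a) (take (Suc (js ! Suc a)) R)"
  have gap: "js ! Suc a \<le> js ! a + r" if a: "Suc a < length js" for a
  proof (rule ccontr)
    assume long: "\<not> ?thesis"
    have sub: "set (?C a) \<subseteq> verts G" and dC: "distinct (?C a)"
      using cyc[OF a] unfolding is_induced_cycle_def is_cycle_def by auto
    have "card (set (?C a)) = length (?C a)" using distinct_card[OF dC] .
    also have "\<dots> \<ge> r" using long js(1)[OF a] by simp
    finally have "induced G (set (?C a)) \<in> {L. super_clean_pinched_ladder L \<and> card (verts L) \<ge> r}"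
      using super_clean_induced_cycle[OF G cyc[OF a]] by simp
    from contains_inducedI[OF sub this] show False using no_ladder by simp
  qed
  have few: "length js < 3 * r"
  proof (rule ccontr)
    assume many: "\<not> length js < 3 * r"
    \<comment> \<open>Only every third segment becomes a petal. Between position
      \<open>js ! Suc (3 * a)\<close> and the next petal there is at least the position
      \<open>js ! Suc (Suc (3 * a))\<close>, so different petals are neither touching nor adjacent
      along \<open>R\<close>.\<close>
    have idx: "Suc (3 * a) < length js" "Suc (Suc (3 * a)) < length js" if "a < r" for a
      using that many by auto
    have seg: "\<exists>k. js ! (3 * a) \<le> k \<and> k \<le> js ! Suc (3 * a) \<and> z = R ! k"
      if "a < r" "z \<in> set (?C (3 * a)) - {v}" for a z
      using set_segment[of "js ! Suc (3 * a)" R z "js ! (3 * a)"] js(1)[OF idx(1)[OF that(1)]]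
          that(2) by auto
    have far: "\<exists>k l. k < length R \<and> l < length R \<and> z = R ! k \<and> z' = R ! l \<and> Suc k < l"
      if ab: "a < b" "b < r" "z \<in> set (?C (3 * a)) - {v}" "z' \<in> set (?C (3 * b)) - {v}" for a b z z'
    proof -
      obtain k where k: "k \<le> js ! Suc (3 * a)" "z = R ! k" using seg[of a z] ab by auto
      obtain l where l: "js ! (3 * b) \<le> l" "l \<le> js ! Suc (3 * b)" "z' = R ! l" using seg[of b z']
          ab by auto
      have "js ! Suc (3 * a) < js ! Suc (Suc (3 * a))" using mono idx[of a] ab by simp
      moreover have "js ! Suc (Suc (3 * a)) < js ! (3 * b)" using mono idx[of b] ab by simp
      moreover have "l < length R" using l(2) js(1)[OF idx(1)[of b]] ab by simp
      ultimately show ?thesis using k l by (intro exI[of _ k] exI[of _ l]) auto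
    qed
    have ok: "z \<noteq> z' \<and> {z, z'} \<notin> edges G"
      if ab: "a < r" "b < r" "a \<noteq> b" and z: "z \<in> set (?C (3 * a)) - {v}" "z' \<in> set (?C (3 * b)) -
          {v}" for a b z z'
    proof -
      have "\<exists>k l. k < length R \<and> l < length R \<and> z = R ! k \<and> z' = R ! l \<and> (Suc k < l \<or> Suc l < k)"
      proof (cases "a < b")
        case True
        then show ?thesis using far[OF True ab(2) z] by blast
      next
        case False
        then have "b < a" using ab by simp
        then show ?thesis using far[OF _ ab(1) z(2,1)] by blast
      qed
      then show ?thesis using d induced_path_edge_iff[OF R] by (auto simp: nth_eq_iff_index_eq)
    qed
    have "contains_induced G {H. is_flower r H}"
    proof (rule contains_flower[OF G, of r "\<lambda>a. ?C (3 * a)" v])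
      fix i assume "i < r" then show "is_induced_cycle G (?C (3 * i)) \<and> v \<in> set (?C (3 * i))"
        using cyc[OF idx(1)] by simp
    next
      fix i j assume "i < r" "j < r" "i \<noteq> j"
      then show "set (?C (3 * i)) \<inter> set (?C (3 * j)) = {v}" using ok[of i j] by fastforce
    next
      fix i j a b
      assume "i < r" "j < r" "i \<noteq> j" "a \<in> set (?C (3 * i)) - {v}" "b \<in> set (?C (3 * j)) - {v}"
      then show "{a, b} \<notin> edges G" using ok[of i j a b] by simp
    qed
    then show False using no_flower by simp
  qed
  have "0 \<in> set js" "length R - 1 \<in> set js" using setjs R0 e by auto
  then obtain a b where ab: "a < length js" "js ! a = 0" "b < length js" "js ! b = length R - 1"
    by (metis in_set_conv_nth)
  \<comment> \<open>Both ends of \<open>R\<close> are neighbours of \<open>v\<close>, so the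
    positions start at 0 and reach \<open>length R - 1\<close>; adding up gaps of at most
    \<open>r\<close> bounds the length.\<close>
  have "js ! 0 = 0" using mono[of 0 a] ab by (cases "a = 0") auto
  then have bound: "k < length js \<Longrightarrow> js ! k \<le> k * r" for k
  proof (induction k)
    case (Suc k)
    then show ?case using gap[of k] by simp
  qed simp
  have "length R - 1 \<le> b * r" using bound[OF ab(3)] ab(4) by simp
  also have "\<dots> \<le> 3 * r * r" using few ab(3) by (intro mult_le_mono1) simp
  finally show ?thesis by simp
qed

section \<open>Complete graphs and thetas\<close>

lemma contains_complete:
  assumes G: "simple_graph G" and A: "A \<subseteq> verts G" "card A = r" "clique A (edges G)"
  shows "contains_induced G {K. is_complete r K}"
proof -
  have "finite A" using G A(1) finite_subset unfolding simple_graph_def by blast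
  moreover have "edges (induced G A) = [A]\<^bsup>2\<^esup>"
  proof
    show "edges (induced G A) \<subseteq> [A]\<^bsup>2\<^esup>"
      using simple_graph_induced[OF G A(1)] unfolding simple_graph_def by simp
    show "[A]\<^bsup>2\<^esup> \<subseteq> edges (induced G A)"
    proof
      fix e assume "e \<in> [A]\<^bsup>2\<^esup>"
      then obtain x y where "e = {x, y}" "x \<in> A" "y \<in> A" "x \<noteq> y" by (rule nsets2_E)
      then show "e \<in> edges (induced G A)" using A(3) unfolding clique_def by simp
    qed
  qed
  ultimately have "induced G A \<in> {K. is_complete r K}" unfolding is_complete_def using A(2) by simp
  then show ?thesis by (rule contains_inducedI[OF A(1)])
qed

text \<open>An edge \<open>st\<close> of \<open>G\<close> is a chord of every path with interior
  vertices and belongs to the induced graph on the union. It is therefore the only chord permitted,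
  and if it exists one of the paths has to use it.\<close>

lemma contains_theta:
  assumes G: "simple_graph G" and st: "s \<noteq> t"
    and P: "\<And>i. i < r \<Longrightarrow> is_path G s (P i) t"
    and E: "\<And>i. i < r \<Longrightarrow> edges (induced G (set (P i))) \<subseteq> insert {s, t} (path_edges (P i))"
    and inj: "inj_on P {..<r}"
    and dis: "\<And>i j. i < r \<Longrightarrow> j < r \<Longrightarrow> i \<noteq> j \<Longrightarrow> set (P i) \<inter> set (P j) = {s, t}"
    and ne: "\<And>i j a b. i < r \<Longrightarrow> j < r \<Longrightarrow> i \<noteq> j \<Longrightarrow> a \<in> set (P i) - {s, t} \<Longrightarrow> b \<in> set (P j) - {s, t} \<Longrightarrow>
      {a, b} \<notin> edges G"
    and adj: "{s, t} \<in> edges G \<Longrightarrow> \<exists>i<r. {s, t} \<in> path_edges (P i)"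
  shows "contains_induced G {H. is_theta r H}"
proof -
  let ?V = "\<Union>i<r. set (P i)"
  let ?H = "induced G ?V"
  have V: "?V \<subseteq> verts G" using is_path_verts[OF P] by blast
  have path: "is_path ?H s (P i) t" if "i < r" for i
    using is_path_induced[OF V] P[OF that] that by blast
  have ends: "s \<in> set (P i)" "t \<in> set (P i)" if "i < r" for i using is_path_ends[OF P[OF that]] by
      auto
  have "edges ?H = (\<Union>i<r. path_edges (P i))"
  proof
    show "edges ?H \<subseteq> (\<Union>i<r. path_edges (P i))"
    proof
      fix e assume "e \<in> edges ?H"
      then have e: "e \<in> edges G" "e \<subseteq> ?V" by (auto simp: edges_induced)
      obtain x y where xy: "e = {x, y}" by (rule edge_simpleE[OF G e(1)])
      then obtain i j where ij: "i < r" "x \<in> set (P i)" "j < r" "y \<in> set (P j)" using e(2) by auto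
      have "\<exists>i<r. e \<subseteq> set (P i)"
      proof (cases "i = j \<or> x \<in> {s, t} \<or> y \<in> {s, t}")
        case True
        then show ?thesis using ij ends xy by auto
      next
        case False
        then show ?thesis using ne[of i j x y] ij e(1) xy by blast
      qed
      then obtain i where i: "i < r" "e \<in> edges (induced G (set (P i)))" using e(1) by (auto simp:
          edges_induced)
      then have "e = {s, t} \<or> e \<in> path_edges (P i)" using E[OF i(1)] by blast
      then show "e \<in> (\<Union>i<r. path_edges (P i))" using i(1) adj e(1) by blast
    qed
    show "(\<Union>i<r. path_edges (P i)) \<subseteq> edges ?H" using is_path_path_edges[OF path] by blast
  qed
  then have "is_theta r ?H"
    unfolding is_theta_def using simple_graph_induced[OF G V] st path inj dis
    by (intro conjI exI[of _ s] exI[of _ t] exI[of _ P]) simp_all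
  then have "?H \<in> {H. is_theta r H}" by simp
  then show ?thesis by (rule contains_inducedI[OF V])
qed

text \<open>Two vertices of \<open>A\<close> serve as the ends, and the \<open>r\<close> vertices of
  \<open>B\<close> as the middle vertices of paths of length two.\<close>

lemma contains_theta_bipartite:
  assumes G: "simple_graph G" and A: "A \<subseteq> verts G" "2 \<le> card A" "indep A (edges G)"
    and B: "B \<subseteq> verts G" "card B = r" "indep B (edges G)" and AB: "A \<inter> B = {}"
    and E: "\<And>a b. a \<in> A \<Longrightarrow> b \<in> B \<Longrightarrow> {a, b} \<in> edges G"
  shows "contains_induced G {H. is_theta r H}"
proof -
  obtain A' where A': "A' \<subseteq> A" "card A' = 2" by (rule obtain_subset_with_card_n[OF A(2)])
  then obtain s t where st: "s \<noteq> t" "s \<in> A" "t \<in> A" by (auto simp: card_2_iff)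
  have nadj: "{s, t} \<notin> edges G" using A(3) st unfolding indep_def by blast
  have "finite B" using G B(1) finite_subset unfolding simple_graph_def by blast
  then obtain f where f: "bij_betw f {..<r} B"
    using ex_bij_betw_nat_finite[of B] B(2) by (auto simp: atLeast0LessThan)
  have fB: "f i \<in> B" if "i < r" for i using bij_betwE[OF f] that by simp
  have finj: "f i \<noteq> f j" if "i < r" "j < r" "i \<noteq> j" for i j
    using bij_betw_imp_inj_on[OF f] that unfolding inj_on_def by blast
  have ne: "f i \<noteq> s" "f i \<noteq> t" if "i < r" for i using fB[OF that] AB st by auto
  show ?thesis
  proof (rule contains_theta[OF G st(1), of r "\<lambda>i. [s, f i, t]"])
    fix i assume i: "i < r"
    have e: "{s, f i} \<in> edges G" "{f i, t} \<in> edges G"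
      using E[OF st(2) fB[OF i]] E[OF st(3) fB[OF i]] by (auto simp: insert_commute)
    then show "is_path G s [s, f i, t] t"
      using edges_simple[OF G e(1)] edges_simple[OF G e(2)] st(1) by (simp add: is_path_Cons)
    show "edges (induced G (set [s, f i, t])) \<subseteq> insert {s, t} (path_edges [s, f i, t])"
    proof
      fix e assume "e \<in> edges (induced G (set [s, f i, t]))"
      then have e: "e \<in> edges G" "e \<subseteq> {s, f i, t}" by (auto simp: edges_induced)
      obtain x y where "e = {x, y}" "x \<noteq> y" by (rule edge_simpleE[OF G e(1)])
      then show "e \<in> insert {s, t} (path_edges [s, f i, t])" using e(2) by (auto simp:
          insert_commute)
    qed
  next
    show "inj_on (\<lambda>i. [s, f i, t]) {..<r}"
      using bij_betw_imp_inj_on[OF f] unfolding inj_on_def by simp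
  next
    fix i j assume "i < r" "j < r" "i \<noteq> j"
    then show "set [s, f i, t] \<inter> set [s, f j, t] = {s, t}" using finj[of i j] ne[of i] ne[of j] by
        auto
  next
    fix i j a b
    assume ij: "i < r" "j < r" "i \<noteq> j" "a \<in> set [s, f i, t] - {s, t}" "b \<in> set [s, f j, t] - {s, t}"
    then have "a = f i" "b = f j" by auto
    then show "{a, b} \<notin> edges G" using B(3) fB finj ij(1-3) unfolding indep_def by blast
  qed (use nadj in blast)
qed

text \<open>Homogeneity only controls pairs \<open>i < j\<close>. Taking \<open>i\<close> from the
  lower and \<open>j\<close> from the upper half turns it into a statement about all pairs, that is,
  into a complete bipartite pattern.\<close>

lemma nat_set_halves:
  assumes "finite (H :: nat set)" "2 * M \<le> card H"
  obtains L U where "L \<subseteq> H" "U \<subseteq> H" "card L = M" "M \<le> card U" "\<And>i j. i \<in> L \<Longrightarrow> j \<in> U \<Longrightarrow> i < j"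
proof -
  let ?xs = "sorted_list_of_set H"
  have s: "sorted_wrt (<) ?xs" "distinct ?xs" "set ?xs = H" "length ?xs = card H" using assms(1)
      by auto
  have app: "sorted_wrt (<) (take M ?xs @ drop M ?xs)" using s(1) by simp
  show ?thesis
  proof (rule that[of "set (take M ?xs)" "set (drop M ?xs)"])
    show "set (take M ?xs) \<subseteq> H" "set (drop M ?xs) \<subseteq> H"
      using s(3) set_take_subset[of M ?xs] set_drop_subset[of M ?xs] by auto
    show "card (set (take M ?xs)) = M" using s assms(2) by (simp add: distinct_card)
    show "M \<le> card (set (drop M ?xs))" using s assms(2) by (simp add: distinct_card)
    show "i < j" if "i \<in> set (take M ?xs)" "j \<in> set (drop M ?xs)" for i j
      using app that unfolding sorted_wrt_append by blast
  qed
qed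

text \<open>Ramsey's theorem for pairs \<open>i < j\<close>, coloured by a pair \<open>(c div D, c mod D)\<close> of adjacent
  positions on the two lists, or by \<open>D * D\<close> if there is none.\<close>

lemma homogeneous_lists:
  "\<exists>N :: nat. \<forall>(E :: 'a set set) R. (\<forall>i<N. length (R i) \<le> D) \<longrightarrow>
     (\<exists>H\<subseteq>{..<N}. card H = m \<and>
        ((\<exists>a b. \<forall>i\<in>H. \<forall>j\<in>H. i < j \<longrightarrow>
            a < length (R i) \<and> b < length (R j) \<and> {R i ! a, R j ! b} \<in> E) \<or>
         (\<forall>i\<in>H. \<forall>j\<in>H. i < j \<longrightarrow> (\<forall>x\<in>set (R i). \<forall>y\<in>set (R j). {x, y} \<notin> E))))"
proof -
  obtain N :: nat where N: "partn_lst {..<N} (replicate (Suc (D * D)) m) 2" using ramsey_full by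
      blast
  show ?thesis
  proof (intro exI[of _ N] allI impI)
    fix E :: "'a set set" and R :: "nat \<Rightarrow> 'a list"
    assume len: "\<forall>i<N. length (R i) \<le> D"
    define adj where "adj i j c \<longleftrightarrow> c div D < length (R i) \<and> c mod D < length (R j) \<and>
      {R i ! (c div D), R j ! (c mod D)} \<in> E" for i j c
    \<comment> \<open>Ramsey's theorem colours unordered pairs; \<open>Min e\<close> and
      \<open>Max e\<close> restore the order of the two indices. Several positions may be adjacent,
      so one code is chosen.\<close>
    define f where "f e = (if \<exists>c<D * D. adj (Min e) (Max e) c
      then SOME c. c < D * D \<and> adj (Min e) (Max e) c else D * D)" for e
    have f_adj: "f e < D * D \<and> adj (Min e) (Max e) (f e)" if "\<exists>c<D * D. adj (Min e) (Max e) c" for e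
    proof -
      have "f e = (SOME c. c < D * D \<and> adj (Min e) (Max e) c)" unfolding f_def by (rule if_P[OF
          that])
      then show ?thesis using someI_ex[OF that] by simp
    qed
    have f_none: "f e = D * D" if "\<not> (\<exists>c<D * D. adj (Min e) (Max e) c)" for e
      unfolding f_def by (rule if_not_P[OF that])
    have "f e < Suc (D * D)" for e using f_adj[of e] f_none[of e] by (cases "\<exists>c<D * D. adj (Min e)
        (Max e) c") auto
    then have "f \<in> [{..<N}]\<^bsup>2\<^esup> \<rightarrow> {..<Suc (D * D)}" by auto
    then obtain c H where "c < length (replicate (Suc (D * D)) m)"
      and H0: "H \<in> nsets {..<N} (replicate (Suc (D * D)) m ! c)" and mono: "f ` [H]\<^bsup>2\<^esup> \<subseteq> {c}"
      by (rule partn_lstE[OF N]) simp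
    then have c: "c < Suc (D * D)" by simp
    have H: "H \<subseteq> {..<N}" "card H = m" using H0 nth_replicate[OF c, of m] unfolding nsets_def by auto
    have col: "f {i, j} = c" if "i \<in> H" "j \<in> H" "i < j" for i j
    proof -
      have "{i, j} \<in> [H]\<^bsup>2\<^esup>" using that by simp
      then show ?thesis using mono by blast
    qed
    have mm: "Min {i, j} = i" "Max {i, j} = j" if "i < j" for i j :: nat using that by auto
    have "(\<exists>a b. \<forall>i\<in>H. \<forall>j\<in>H. i < j \<longrightarrow>
            a < length (R i) \<and> b < length (R j) \<and> {R i ! a, R j ! b} \<in> E) \<or>
         (\<forall>i\<in>H. \<forall>j\<in>H. i < j \<longrightarrow> (\<forall>x\<in>set (R i). \<forall>y\<in>set (R j). {x, y} \<notin> E))"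
    proof (cases "c = D * D")
      case False
      have "adj i j c" if ij: "i \<in> H" "j \<in> H" "i < j" for i j
      proof -
        have "f {i, j} \<noteq> D * D" using col[OF ij] False by simp
        then have "adj (Min {i, j}) (Max {i, j}) (f {i, j})" using f_none f_adj by blast
        then show ?thesis unfolding mm[OF ij(3)] col[OF ij] .
      qed
      then show ?thesis unfolding adj_def by blast
    next
      case True
      have "{x, y} \<notin> E" if ij: "i \<in> H" "j \<in> H" "i < j" and xy: "x \<in> set (R i)" "y \<in> set (R j)" for
          i j x y
      proof
        assume e: "{x, y} \<in> E"
        obtain a b where ab: "a < length (R i)" "x = R i ! a" "b < length (R j)" "y = R j ! b"
          using xy by (metis in_set_conv_nth)
        have lt: "i < N" "j < N" using ij H(1) by auto
        have aD: "a < D" "b < D" using ab(1,3) len lt by (meson order_less_le_trans)+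
        \<comment> \<open>The code of the positions \<open>(a, b)\<close> is
          \<open>a * D + b\<close>; as both are below \<open>D\<close>, it can be decoded and is
          smaller than \<open>D * D\<close>.\<close>
        have dm: "(a * D + b) div D = a" "(a * D + b) mod D = b" using aD by auto
        have "a * D + b < Suc a * D" using aD by simp
        also have "\<dots> \<le> D * D" using aD by (intro mult_le_mono1) simp
        finally have "a * D + b < D * D" .
        moreover have "adj i j (a * D + b)" unfolding adj_def dm using ab e by simp
        ultimately have "\<exists>c<D * D. adj (Min {i, j}) (Max {i, j}) c" unfolding mm[OF ij(3)] by blast
        then show False using f_adj col[OF ij] True by fastforce
      qed
      then show ?thesis by blast
    qed
    then show "\<exists>H\<subseteq>{..<N}. card H = m \<and>
        ((\<exists>a b. \<forall>i\<in>H. \<forall>j\<in>H. i < j \<longrightarrow>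
            a < length (R i) \<and> b < length (R j) \<and> {R i ! a, R j ! b} \<in> E) \<or>
         (\<forall>i\<in>H. \<forall>j\<in>H. i < j \<longrightarrow> (\<forall>x\<in>set (R i). \<forall>y\<in>set (R j). {x, y} \<notin> E)))"
      using H by blast
  qed
qed

text \<open>Shortening takes place in \<open>G\<close> without the edge \<open>vw\<close>, for
  otherwise the path could collapse to this edge. The initial path avoids \<open>vw\<close> because
  its first step goes to \<open>y\<close>, which is not \<open>w\<close>.\<close>

lemma chordless_detour:
  assumes G: "simple_graph G" and p: "is_path G y p w" and v: "v \<notin> set p" "{v, y} \<in> edges G" "y \<noteq> w"
  obtains Q where "is_path G v Q w" "{v, w} \<notin> path_edges Q" "set Q \<subseteq> insert v (set p)"
    "edges (induced G (set Q)) \<subseteq> insert {v, w} (path_edges Q)"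
proof -
  let ?D = "del_edges G {{v, w}}"
  have ends: "hd p = y" "p \<noteq> []" using is_path_ends[OF p] by auto
  have vp: "is_path G v (v # p) w" using p v ends edges_simple[OF G v(2)] by (simp add:
      is_path_Cons)
  have "{v, w} \<notin> path_edges p" using path_edges_subset[of "{v, w}" p] v(1) by blast
  moreover have "{v, w} \<noteq> {v, y}" using v(3) by (auto simp: doubleton_eq_iff)
  ultimately have "{v, w} \<notin> path_edges (v # p)" using ends by (simp add: path_edges_Cons)
  then have "is_path ?D v (v # p) w" using vp by (simp add: is_path_del_edges)
  then obtain Q where Q: "is_induced_path ?D v Q w" "set Q \<subseteq> set (v # p)"
    using induced_path_exists[OF simple_graph_del_edges[OF G]] by metis
  then have "edges (induced ?D (set Q)) = path_edges Q"
    unfolding is_induced_path_def path_graph_def by simp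
  then have "edges (induced G (set Q)) \<subseteq> insert {v, w} (path_edges Q)"
    unfolding edges_induced del_edges_def by auto
  moreover have "is_path G v Q w" "{v, w} \<notin> path_edges Q"
    using Q(1) unfolding is_induced_path_def is_path_del_edges by auto
  ultimately show ?thesis using that Q(2) by simp
qed

text \<open>Prefixing \<open>v\<close> and shortening turns each path into a detour from
  \<open>v\<close> to \<open>w\<close> inside its own vertices. The detours keep an interior vertex,
  which makes them pairwise distinct.\<close>

lemma contains_theta_paths:
  assumes G: "simple_graph G" and vw: "v \<noteq> w" and r: "1 \<le> r"
    and p: "\<And>i. i < r \<Longrightarrow> is_path G (y i) (p i) w \<and> v \<notin> set (p i) \<and> {v, y i} \<in> edges G \<and> y i \<noteq> w"
    and dis: "\<And>i j. i < r \<Longrightarrow> j < r \<Longrightarrow> i \<noteq> j \<Longrightarrow> set (p i) \<inter> set (p j) = {w}"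
    and ne: "\<And>i j a b. i < r \<Longrightarrow> j < r \<Longrightarrow> i \<noteq> j \<Longrightarrow> a \<in> set (p i) - {w} \<Longrightarrow> b \<in> set (p j) - {w} \<Longrightarrow>
      {a, b} \<notin> edges G"
  shows "contains_induced G {H. is_theta r H}"
proof -
  have "\<exists>Q. is_path G v Q w \<and> {v, w} \<notin> path_edges Q \<and> set Q \<subseteq> insert v (set (p i)) \<and>
    edges (induced G (set Q)) \<subseteq> insert {v, w} (path_edges Q)" if i: "i < r" for i
  proof -
    have pi: "is_path G (y i) (p i) w" "v \<notin> set (p i)" "{v, y i} \<in> edges G" "y i \<noteq> w" using p[OF
        i] by auto
    show ?thesis by (rule chordless_detour[OF G pi]) blast
  qed
  then obtain Q where Q: "\<And>i. i < r \<Longrightarrow> is_path G v (Q i) w" "\<And>i. i < r \<Longrightarrow> {v, w} \<notin> path_edges (Q i)"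
    "\<And>i. i < r \<Longrightarrow> set (Q i) \<subseteq> insert v (set (p i))"
    "\<And>i. i < r \<Longrightarrow> edges (induced G (set (Q i))) \<subseteq> insert {v, w} (path_edges (Q i))"
    by metis
  have vw_in: "v \<in> set (Q i)" "w \<in> set (Q i)" if "i < r" for i using is_path_ends[OF Q(1)[OF
      that]] by auto
  have disQ: "set (Q i) \<inter> set (Q j) = {v, w}" if ij: "i < r" "j < r" "i \<noteq> j" for i j
  proof
    show "set (Q i) \<inter> set (Q j) \<subseteq> {v, w}" using Q(3)[OF ij(1)] Q(3)[OF ij(2)] dis[OF ij] by blast
    show "{v, w} \<subseteq> set (Q i) \<inter> set (Q j)" using vw_in ij by blast
  qed
  have neQ: "{a, b} \<notin> edges G" if ij: "i < r" "j < r" "i \<noteq> j"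
    and ab: "a \<in> set (Q i) - {v, w}" "b \<in> set (Q j) - {v, w}" for i j a b
  proof (rule ne[OF ij])
    show "a \<in> set (p i) - {w}" using ab(1) Q(3)[OF ij(1)] by blast
    show "b \<in> set (p j) - {w}" using ab(2) Q(3)[OF ij(2)] by blast
  qed
  have long: "set (Q i) \<noteq> {v, w}" if i: "i < r" for i
  proof
    assume eq: "set (Q i) = {v, w}"
    have "3 \<le> length (Q i)" by (rule is_path_length_3[OF Q(1)[OF i] vw Q(2)[OF i]])
    moreover have "length (Q i) = card (set (Q i))" using is_path_ends[OF Q(1)[OF i]]
        distinct_card by metis
    moreover have "card {v, w} \<le> 2" by (simp add: card_insert_if)
    ultimately show False unfolding eq by simp
  qed
  have injQ: "Q i \<noteq> Q j" if ij: "i < r" "j < r" "i \<noteq> j" for i j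
  proof
    assume "Q i = Q j"
    then have "set (Q i) = set (Q i) \<inter> set (Q j)" by simp
    then show False using disQ[OF ij] long[OF ij(1)] by simp
  qed
  show ?thesis
  proof (cases "{v, w} \<in> edges G")
    case False
    show ?thesis
    proof (rule contains_theta[OF G vw, of r Q])
      show "inj_on Q {..<r}" using injQ unfolding inj_on_def by blast
      show "\<exists>i<r. {v, w} \<in> path_edges (Q i)" if "{v, w} \<in> edges G" using that False by simp
    qed (fact Q(1) Q(4) disQ neQ)+
  next
    case True
    \<comment> \<open>The edge \<open>vw\<close> must belong to an induced theta, so it takes the
      place of one detour; \<open>1 \<le> r\<close> ensures that index 0 exists.\<close>
    let ?P = "\<lambda>i. if i = 0 then [v, w] else Q i"
    have vwV: "v \<in> verts G" "w \<in> verts G" using edges_simple[OF G True] by auto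
    show ?thesis
    proof (rule contains_theta[OF G vw, of r ?P])
      show "is_path G v (?P i) w" if "i < r" for i
        using that Q(1) True vw vwV by (auto simp: is_path_Cons)
      show "edges (induced G (set (?P i))) \<subseteq> insert {v, w} (path_edges (?P i))" if i: "i < r" for i
      proof (cases "i = 0")
        case True
        show ?thesis
        proof
          fix e assume "e \<in> edges (induced G (set (?P i)))"
          then have e: "e \<in> edges G" "e \<subseteq> {v, w}" using True by (auto simp: edges_induced)
          obtain a b where "e = {a, b}" "a \<noteq> b" by (rule edge_simpleE[OF G e(1)])
          then show "e \<in> insert {v, w} (path_edges (?P i))" using e(2) by auto
        qed
      next
        case False
        then show ?thesis using Q(4)[OF i] by simp
      qed
      show "inj_on ?P {..<r}"
      proof (rule inj_onI)
        fix i j assume ij: "i \<in> {..<r}" "j \<in> {..<r}" "?P i = ?P j"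
        have "Q k \<noteq> [v, w]" if k: "k < r" for k
        proof
          assume "Q k = [v, w]"
          from arg_cong[OF this, of set] show False using long[OF k] by simp
        qed
        from this[of i] this[of j] show "i = j" using ij injQ[of i j] by (auto split: if_splits)
      qed
      show "set (?P i) \<inter> set (?P j) = {v, w}" if "i < r" "j < r" "i \<noteq> j" for i j
        using disQ[OF that] vw_in that by auto
      show "{a, b} \<notin> edges G" if "i < r" "j < r" "i \<noteq> j" "a \<in> set (?P i) - {v, w}" "b \<in> set (?P j)
          - {v, w}" for i j a b
        using neQ[of i j a b] that by (auto split: if_splits)
      show "\<exists>i<r. {v, w} \<in> path_edges (?P i)" using r by (intro exI[of _ 0]) auto
    qed
  qed
qed

text \<open>The size \<open>2 * M + r\<close> of the homogeneous set serves both outcomes: two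
  halves of size at least \<open>M\<close>, the Ramsey number for \<open>r\<close> and
  \<open>r\<close>, if there are edges at fixed positions, and \<open>r\<close> paths for a theta if
  there are none.\<close>

lemma complete_or_theta_of_paths:
  assumes r: "2 \<le> r"
  shows "\<exists>N. \<forall>(G :: 'a graph) v w Y p. simple_graph G \<longrightarrow> finite Y \<longrightarrow> card Y = N \<longrightarrow> v \<noteq> w \<longrightarrow>
    (\<forall>y\<in>Y. is_path G y (p y) w \<and> length (p y) \<le> D \<and> v \<notin> set (p y) \<and> {v, y} \<in> edges G \<and> y \<noteq> w) \<longrightarrow>
    (\<forall>y\<in>Y. \<forall>y'\<in>Y. y \<noteq> y' \<longrightarrow> set (p y) \<inter> set (p y') = {w}) \<longrightarrow>
    contains_induced G {K. is_complete r K} \<or> contains_induced G {H. is_theta r H}"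
proof -
  obtain M where M: "\<And>(V :: 'a set) E. finite V \<Longrightarrow> M \<le> card V \<Longrightarrow>
      \<exists>R \<subseteq> V. card R = r \<and> clique R E \<or> card R = r \<and> indep R E"
    using ramsey2[of r r] by blast
  obtain N :: nat where N: "\<forall>(E :: 'a set set) R. (\<forall>i<N. length (R i) \<le> D) \<longrightarrow>
     (\<exists>H\<subseteq>{..<N}. card H = 2 * M + r \<and>
        ((\<exists>a b. \<forall>i\<in>H. \<forall>j\<in>H. i < j \<longrightarrow>
            a < length (R i) \<and> b < length (R j) \<and> {R i ! a, R j ! b} \<in> E) \<or>
         (\<forall>i\<in>H. \<forall>j\<in>H. i < j \<longrightarrow> (\<forall>x\<in>set (R i). \<forall>y\<in>set (R j). {x, y} \<notin> E))))"
    using homogeneous_lists[of D "2 * M + r"] ..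
  show ?thesis
  proof (intro exI[of _ N] allI impI)
    fix G :: "'a graph" and v w Y p
    assume G: "simple_graph G" and Y: "finite Y" "card Y = N" and vw: "v \<noteq> w"
      and p: "\<forall>y\<in>Y. is_path G y (p y) w \<and> length (p y) \<le> D \<and> v \<notin> set (p y) \<and> {v, y} \<in> edges G \<and> y
          \<noteq> w"
      and dis: "\<forall>y\<in>Y. \<forall>y'\<in>Y. y \<noteq> y' \<longrightarrow> set (p y) \<inter> set (p y') = {w}"
    obtain f where f: "bij_betw f {..<N} Y"
      using ex_bij_betw_nat_finite[OF Y(1)] Y(2) by (auto simp: atLeast0LessThan)
    have fY: "f i \<in> Y" if "i < N" for i using bij_betwE[OF f] that by simp
    have finj: "f i \<noteq> f j" if "i < N" "j < N" "i \<noteq> j" for i j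
      using bij_betw_imp_inj_on[OF f] that unfolding inj_on_def by blast
    \<comment> \<open>The common end \<open>w\<close> is removed, which makes the lists pairwise
      disjoint; edges at \<open>w\<close> would otherwise spoil the colouring.\<close>
    define R where "R i = butlast (p (f i))" for i
    have pf: "is_path G (f i) (p (f i)) w" "length (p (f i)) \<le> D" "v \<notin> set (p (f i))" "{v, f i} \<in>
        edges G" "f i \<noteq> w"
      if "i < N" for i using p fY[OF that] by auto
    have setR: "set (p (f i)) = insert w (set (R i))" "w \<notin> set (R i)" if "i < N" for i
    proof -
      have ends: "p (f i) \<noteq> []" "last (p (f i)) = w" "distinct (p (f i))" using is_path_ends[OF
          pf(1)[OF that]] by auto
      have eq: "R i @ [w] = p (f i)" unfolding R_def using append_butlast_last_id[OF ends(1)]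
          ends(2) by simp
      have "set (R i @ [w]) = insert w (set (R i))" by simp
      then show "set (p (f i)) = insert w (set (R i))" unfolding eq .
      have "distinct (R i @ [w])" unfolding eq by (rule ends(3))
      then show "w \<notin> set (R i)" by simp
    qed
    have RV: "set (R i) \<subseteq> verts G" if "i < N" for i
      using is_path_verts[OF pf(1)[OF that]] setR(1)[OF that] by blast
    have disR: "set (R i) \<inter> set (R j) = {}" if ij: "i < N" "j < N" "i \<noteq> j" for i j
    proof -
      have "set (p (f i)) \<inter> set (p (f j)) = {w}" using dis fY finj ij by blast
      then show ?thesis using setR[OF ij(1)] setR[OF ij(2)] by auto
    qed
    have "\<forall>i<N. length (R i) \<le> D" unfolding R_def using pf(2) by (simp add: le_diff_conv le_SucI)
    from N[THEN spec[of _ "edges G"], THEN spec, THEN mp, OF this] obtain H where H: "H \<subseteq> {..<N}"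
        "card H = 2 * M + r"
      and hom: "(\<exists>a b. \<forall>i\<in>H. \<forall>j\<in>H. i < j \<longrightarrow>
            a < length (R i) \<and> b < length (R j) \<and> {R i ! a, R j ! b} \<in> edges G) \<or>
         (\<forall>i\<in>H. \<forall>j\<in>H. i < j \<longrightarrow> (\<forall>x\<in>set (R i). \<forall>y\<in>set (R j). {x, y} \<notin> edges G))" by blast
    have finH: "finite H" using H(1) finite_subset by blast
    show "contains_induced G {K. is_complete r K} \<or> contains_induced G {H. is_theta r H}"
      using hom
    proof
      assume "\<exists>a b. \<forall>i\<in>H. \<forall>j\<in>H. i < j \<longrightarrow>
            a < length (R i) \<and> b < length (R j) \<and> {R i ! a, R j ! b} \<in> edges G"
      then obtain a b where ab: "\<And>i j. i \<in> H \<Longrightarrow> j \<in> H \<Longrightarrow> i < j \<Longrightarrow>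
            a < length (R i) \<and> b < length (R j) \<and> {R i ! a, R j ! b} \<in> edges G" by blast
      obtain L U where LU: "L \<subseteq> H" "U \<subseteq> H" "card L = M" "M \<le> card U" "\<And>i j. i \<in> L \<Longrightarrow> j \<in> U \<Longrightarrow> i < j"
        using nat_set_halves[OF finH, of M] H(2) by auto
      show ?thesis
      proof (cases "L = {} \<or> U = {}")
        case True
        \<comment> \<open>An empty half would mean \<open>M = 0\<close>, and Ramsey's theorem would
          then find \<open>r\<close> vertices in the empty set.\<close>
        then have "M = 0" using LU(3,4) by auto
        then have "\<exists>R \<subseteq> {} :: 'a set. card R = r \<and> clique R (edges G) \<or> card R = r \<and> indep R
            (edges G)"
          using M[of "{}"] by simp
        then have "r = 0" by auto
        then show ?thesis using r by simp
      next
        case False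
        then obtain l u where lu: "l \<in> L" "u \<in> U" by blast
        have La: "a < length (R i)" "i < N" if "i \<in> L" for i
          using ab[of i u] LU(5)[OF that lu(2)] that lu LU(1,2) H(1) by auto
        have Ub: "b < length (R j)" "j < N" if "j \<in> U" for j
          using ab[of l j] LU(5)[OF lu(1) that] that lu LU(1,2) H(1) by auto
        let ?A = "(\<lambda>i. R i ! a) ` L" and ?B = "(\<lambda>j. R j ! b) ` U"
        have finLU: "finite L" "finite U" using LU finH finite_subset by auto
        have ne: "x \<noteq> y" if "x \<in> set (R i)" "y \<in> set (R j)" "i < N" "j < N" "i \<noteq> j" for x y i j
          using disR[OF that(3-5)] that(1,2) by blast
        have "inj_on (\<lambda>i. R i ! a) L"
          by (rule inj_onI) (metis La ne nth_mem)
        then have cA: "M \<le> card ?A" using LU(3) by (simp add: card_image)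
        have "inj_on (\<lambda>j. R j ! b) U"
          by (rule inj_onI) (metis Ub ne nth_mem)
        then have cB: "M \<le> card ?B" using LU(4) by (simp add: card_image)
        have AV: "?A \<subseteq> verts G" using RV La nth_mem by blast
        have BV: "?B \<subseteq> verts G" using RV Ub nth_mem by blast
        obtain A where A: "A \<subseteq> ?A" "card A = r" "clique A (edges G) \<or> indep A (edges G)"
          using M[OF finite_imageI[OF finLU(1)] cA] by blast
        obtain B where B: "B \<subseteq> ?B" "card B = r" "clique B (edges G) \<or> indep B (edges G)"
          using M[OF finite_imageI[OF finLU(2)] cB] by blast
        have AV': "A \<subseteq> verts G" "B \<subseteq> verts G" using A(1) B(1) AV BV by auto
        show ?thesis
        proof (cases "clique A (edges G) \<or> clique B (edges G)")
          case True
          then show ?thesis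
            using contains_complete[OF G AV'(1) A(2)] contains_complete[OF G AV'(2) B(2)] by blast
        next
          case False
          then have ind: "indep A (edges G)" "indep B (edges G)" using A(3) B(3) by auto
          have E: "{x, y} \<in> edges G" if xy: "x \<in> A" "y \<in> B" for x y
          proof -
            obtain i j where "i \<in> L" "x = R i ! a" "j \<in> U" "y = R j ! b" using xy A(1) B(1) by blast
            then show ?thesis using ab[of i j] LU(1,2,5) by blast
          qed
          \<comment> \<open>A common vertex would be adjacent to itself.\<close>
          then have "A \<inter> B = {}" using edges_simple[OF G] by blast
          then have "contains_induced G {H. is_theta r H}"
            using contains_theta_bipartite[OF G AV'(1) _ ind(1) AV'(2) B(2) ind(2)] A(2) r E by
                blast
          then show ?thesis ..
        qed
      qed
    next
      assume none: "\<forall>i\<in>H. \<forall>j\<in>H. i < j \<longrightarrow> (\<forall>x\<in>set (R i). \<forall>y\<in>set (R j). {x, y} \<notin> edges G)"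
      have "r \<le> card H" using H(2) by simp
      then obtain H' where H': "H' \<subseteq> H" "card H' = r" by (rule obtain_subset_with_card_n)
      have "finite H'" using H'(1) finH finite_subset by blast
      then obtain g where g: "bij_betw g {..<r} H'"
        using ex_bij_betw_nat_finite[of H'] H'(2) by (auto simp: atLeast0LessThan)
      have gH: "g i \<in> H" "g i < N" if "i < r" for i using bij_betwE[OF g] H'(1) H(1) that by auto
      have ginj: "g i \<noteq> g j" if "i < r" "j < r" "i \<noteq> j" for i j
        using bij_betw_imp_inj_on[OF g] that unfolding inj_on_def by blast
      have noedge: "{x, y} \<notin> edges G" if ij: "i \<in> H" "j \<in> H" "i \<noteq> j" and xy: "x \<in> set (R i)" "y \<in>
          set (R j)" for i j x y
      proof (cases "i < j")
        case True then show ?thesis using none ij xy by blast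
      next
        case False
        then have "j < i" using ij by simp
        then have "{y, x} \<notin> edges G" using none ij xy by blast
        then show ?thesis by (simp add: insert_commute)
      qed
      have "contains_induced G {H. is_theta r H}"
      proof (rule contains_theta_paths[OF G vw, of r "\<lambda>i. f (g i)" "\<lambda>i. p (f (g i))"])
        show "1 \<le> r" using r by simp
        show "is_path G (f (g i)) (p (f (g i))) w \<and> v \<notin> set (p (f (g i))) \<and> {v, f (g i)} \<in> edges G
            \<and> f (g i) \<noteq> w"
          if "i < r" for i using pf[OF gH(2)[OF that]] by blast
        show "set (p (f (g i))) \<inter> set (p (f (g j))) = {w}" if "i < r" "j < r" "i \<noteq> j" for i j
          by (rule dis[rule_format, OF fY[OF gH(2)] fY[OF gH(2)] finj[OF gH(2) gH(2) ginj]]) (fact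
              that)+
        fix i j x y
        assume ij: "i < r" "j < r" "i \<noteq> j" and xy: "x \<in> set (p (f (g i))) - {w}" "y \<in> set (p (f (g
            j))) - {w}"
        have "x \<in> set (R (g i))" "y \<in> set (R (g j))"
          using xy setR(1)[OF gH(2)[OF ij(1)]] setR(1)[OF gH(2)[OF ij(2)]] by auto
        then show "{x, y} \<notin> edges G" using noedge[OF gH(1)[OF ij(1)] gH(1)[OF ij(2)] ginj[OF ij]]
            by blast
      qed
      then show ?thesis ..
    qed
  qed
qed

section \<open>A vertex of large degree\<close>

lemma induced_path_del_vert:
  assumes "is_induced_path (del_vert G v) x R y"
  shows "is_induced_path G x R y" "v \<notin> set R"
proof -
  have p: "is_path (del_vert G v) x R y" "induced (del_vert G v) (set R) = path_graph R"
    using assms unfolding is_induced_path_def by auto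
  then have R: "is_path G x R y" "set R \<subseteq> verts G - {v}"
    unfolding del_vert_def using is_path_induced[of "verts G - {v}" G] by auto
  then have "induced G (set R) = path_graph R"
    using p(2) induced_induced[OF R(2), of G] unfolding del_vert_def by simp
  then show "is_induced_path G x R y" "v \<notin> set R" using R unfolding is_induced_path_def by auto
qed

text \<open>Since \<open>vx\<close> is not a bridge, some path from \<open>x\<close> to
  \<open>v\<close> avoids this edge. Its last vertex before \<open>v\<close> is a second neighbour
  of \<open>v\<close>, joined to \<open>x\<close> inside \<open>G - v\<close>.\<close>

lemma cycle_through_component:
  assumes G: "simple_graph G" "k_edge_connected 2 G" and e: "{v, x} \<in> edges G"
  shows "\<exists>C. is_induced_cycle G C \<and> v \<in> set C \<and>
    (\<forall>z\<in>set C - {v}. \<exists>zs. is_path (del_vert G v) x zs z)"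
proof -
  let ?H = "del_vert G v"
  have H: "simple_graph ?H" unfolding del_vert_def using simple_graph_induced[OF G(1)] by simp
  have V: "v \<in> verts G" "x \<in> verts G" "v \<noteq> x" using edges_simple[OF G(1) e] by auto
  obtain xs where xs: "is_path G x xs v" "{v, x} \<notin> path_edges xs"
    using bridgeless_between_verts[OF G(2) V(2,1)] unfolding bridgeless_between_def by blast
  have xs_ends: "xs \<noteq> []" "hd xs = x" "last xs = v" "distinct xs" using is_path_ends[OF xs(1)] by
      auto
  define ys where "ys = butlast xs"
  have xs_eq: "xs = ys @ [v]" unfolding ys_def using append_butlast_last_id[OF xs_ends(1)]
      xs_ends(3) by simp
  have ys0: "ys \<noteq> []" using xs_eq xs_ends V by auto
  have "is_path G x (ys @ [v]) v" using xs(1) xs_eq by simp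
  then have ys: "is_path G x ys (last ys)" "{last ys, v} \<in> edges G" "v \<notin> set ys"
    using ys0 is_path_append[of ys "[v]" G x v] by auto
  have "set ys \<subseteq> verts G - {v}" using is_path_verts[OF ys(1)] ys(3) by blast
  then have "is_path ?H x ys (last ys)" unfolding del_vert_def using ys(1) by (subst
      is_path_induced) auto
  then obtain R where RH: "is_induced_path ?H x R (last ys)"
    using induced_path_exists[OF H] by metis
  then have RpH: "is_path ?H x R (last ys)" unfolding is_induced_path_def by blast
  note R = induced_path_del_vert[OF RH]
  have Rends: "R \<noteq> []" "R ! 0 = x" "R ! (length R - 1) = last ys"
    using is_path_ends[OF RpH] hd_conv_nth last_conv_nth by metis+
  have xy: "x \<noteq> last ys"
  proof
    assume "x = last ys"
    then have "{v, x} \<in> path_edges (ys @ [v])" using ys0 by (simp add: path_edges_append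
        insert_commute)
    then show False using xs(2) xs_eq by simp
  qed
  then have "length R \<noteq> 1" using Rends by auto
  then have len: "1 < length R" using Rends(1) by (cases R) auto
  have ex: "0 < length R - 1 \<and> {v, R ! (length R - 1)} \<in> edges G" using len ys(2) Rends by (simp
      add: insert_commute)
  \<comment> \<open>An induced path in \<open>G - v\<close> may meet further neighbours of
    \<open>v\<close>. Position 0 is \<open>x\<close> itself, so the path is cut at the first
    neighbour at a positive position.\<close>
  define j where "j = (LEAST j. 0 < j \<and> {v, R ! j} \<in> edges G)"
  have j: "0 < j \<and> {v, R ! j} \<in> edges G"
    unfolding j_def by (rule LeastI[where P = "\<lambda>j. 0 < j \<and> {v, R ! j} \<in> edges G", OF ex])
  have jl: "j \<le> length R - 1"
    unfolding j_def by (rule Least_le[where P = "\<lambda>j. 0 < j \<and> {v, R ! j} \<in> edges G", OF ex])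
  have gap: "{v, R ! k} \<notin> edges G" if "0 < k" "k < j" for k
    using not_less_Least[where P = "\<lambda>j. 0 < j \<and> {v, R ! j} \<in> edges G" and k = k] that unfolding
        j_def by blast
  have "j < length R" using jl len by simp
  then have "is_induced_cycle G (v # drop 0 (take (Suc j) R))"
    using consecutive_cycle[OF G(1) R, of 0 j] j gap e Rends by simp
  moreover have "\<exists>zs. is_path ?H x zs z" if z: "z \<in> set (v # drop 0 (take (Suc j) R)) - {v}" for z
  proof -
    have "z \<in> set R" using z by (auto dest: in_set_takeD)
    then obtain a b where "R = a @ z # b" using split_list by metis
    then show ?thesis using is_path_prefix[of ?H x a z b] RpH by blast
  qed
  ultimately show ?thesis by (intro exI[of _ "v # drop 0 (take (Suc j) R)"]) simp
qed

text \<open>Components of \<open>G - v\<close> are represented as reachability sets of neighbours of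
  \<open>v\<close>. Choosing one cycle through \<open>v\<close> per component gives petals, and
  there are no edges between different components.\<close>

lemma few_components:
  assumes G: "simple_graph G" "k_edge_connected 2 G"
    and no_flower: "\<not> contains_induced G {H. is_flower r H}"
  shows "card ((\<lambda>x. {y. \<exists>zs. is_path (del_vert G v) x zs y}) ` {x. {v, x} \<in> edges G}) < r"
    (is "card (?comp ` ?N) < r")
proof (rule ccontr)
  let ?H = "del_vert G v"
  have VH: "verts ?H = verts G - {v}" unfolding del_vert_def by simp
  assume "\<not> ?thesis"
  then have "r \<le> card (?comp ` ?N)" by simp
  then obtain K where K: "K \<subseteq> ?comp ` ?N" "card K = r" "finite K" by (rule
      obtain_subset_with_card_n)
  obtain g where g: "bij_betw g {..<r} K"
    using ex_bij_betw_nat_finite[OF K(3)] K(2) by (auto simp: atLeast0LessThan)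
  have gK: "g i \<in> ?comp ` ?N" if "i < r" for i using bij_betwE[OF g] K(1) that by auto
  have ginj: "g i \<noteq> g j" if "i < r" "j < r" "i \<noteq> j" for i j
    using bij_betw_imp_inj_on[OF g] that unfolding inj_on_def by blast
  have "\<exists>C. is_induced_cycle G C \<and> v \<in> set C \<and> set C - {v} \<subseteq> g i" if i: "i < r" for i
  proof -
    obtain x where x: "{v, x} \<in> edges G" "g i = ?comp x" using gK[OF i] by blast
    obtain C where "is_induced_cycle G C" "v \<in> set C" "\<forall>z\<in>set C - {v}. \<exists>zs. is_path ?H x zs z"
      using cycle_through_component[OF G x(1)] by blast
    then show ?thesis unfolding x(2) by blast
  qed
  then obtain C where C: "\<And>i. i < r \<Longrightarrow> is_induced_cycle G (C i)" "\<And>i. i < r \<Longrightarrow> v \<in> set (C i)"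
    "\<And>i. i < r \<Longrightarrow> set (C i) - {v} \<subseteq> g i" by metis
  have linked: "?comp x = ?comp y" if xy: "is_path ?H x zs y" for x y zs
  proof -
    have "?comp x \<subseteq> ?comp y" if p: "is_path ?H x zs y" for x y zs
    proof
      fix z assume "z \<in> ?comp x"
      then obtain q where q: "is_path ?H x q z" by blast
      obtain q' where "is_path ?H y q' z" by (rule is_path_trans[OF is_path_rev[OF p] q])
      then show "z \<in> ?comp y" by blast
    qed
    from this[OF xy] this[OF is_path_rev[OF xy]] show ?thesis by blast
  qed
  have sep: "a \<noteq> b \<and> {a, b} \<notin> edges G" if ij: "i < r" "j < r" "i \<noteq> j"
    and ab: "a \<in> set (C i) - {v}" "b \<in> set (C j) - {v}" for i j a b
  proof (rule ccontr)
    assume bad: "\<not> (a \<noteq> b \<and> {a, b} \<notin> edges G)"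
    obtain x where x: "g i = ?comp x" using gK[OF ij(1)] by blast
    obtain y where y: "g j = ?comp y" using gK[OF ij(2)] by blast
    obtain p where p: "is_path ?H x p a" using C(3)[OF ij(1)] ab(1) x by blast
    obtain q where q: "is_path ?H y q b" using C(3)[OF ij(2)] ab(2) y by blast
    have aV: "a \<in> verts ?H" "b \<in> verts ?H"
      using is_path_ends[OF p] is_path_verts[OF p] is_path_ends[OF q] is_path_verts[OF q] by auto
    have "\<exists>zs. is_path ?H a zs b"
    proof (cases "a = b")
      case True
      then have "is_path ?H a [a] b" using aV by simp
      then show ?thesis by blast
    next
      case False
      then have "{a, b} \<in> edges ?H" using bad aV VH unfolding del_vert_def by simp
      then have "is_path ?H a [a, b] b" using False aV by (simp add: is_path_Cons)
      then show ?thesis by blast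
    qed
    then obtain zs where zs: "is_path ?H a zs b" by blast
    have "?comp x = ?comp a" by (rule linked[OF p])
    also have "\<dots> = ?comp b" by (rule linked[OF zs])
    also have "\<dots> = ?comp y" by (rule linked[OF q, symmetric])
    finally show False using ginj[OF ij] x y by simp
  qed
  have "contains_induced G {H. is_flower r H}"
  proof (rule contains_flower[OF G(1), of r C v])
    show "is_induced_cycle G (C i) \<and> v \<in> set (C i)" if "i < r" for i using C(1,2)[OF that] by blast
    show "set (C i) \<inter> set (C j) = {v}" if ij: "i < r" "j < r" "i \<noteq> j" for i j
    proof
      show "set (C i) \<inter> set (C j) \<subseteq> {v}" using sep[OF ij] by blast
      show "{v} \<subseteq> set (C i) \<inter> set (C j)" using C(2) ij by blast
    qed
    show "{a, b} \<notin> edges G" if "i < r" "j < r" "i \<noteq> j" "a \<in> set (C i) - {v}" "b \<in> set (C j) - {v}"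
        for i j a b
      using sep[OF that] by blast
  qed
  then show False using no_flower by simp
qed

lemma degree_bounded:
  assumes r: "2 \<le> r"
  shows "\<exists>d. \<forall>(G :: 'a graph) v. simple_graph G \<longrightarrow> k_edge_connected 2 G \<longrightarrow>
    \<not> contains_induced G {K. is_complete r K} \<longrightarrow>
    \<not> contains_induced G {H. is_flower r H} \<longrightarrow>
    \<not> contains_induced G {L. super_clean_pinched_ladder L \<and> card (verts L) \<ge> r} \<longrightarrow>
    \<not> contains_induced G {H. is_theta r H} \<longrightarrow> card {x. {v, x} \<in> edges G} \<le> d"
proof -
  define D where "D = Suc (3 * r * r)"
  obtain n where n: "\<forall>(G :: 'a graph) v w Y p. simple_graph G \<longrightarrow> finite Y \<longrightarrow> card Y = n \<longrightarrow> v \<noteq> w \<longrightarrow>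
    (\<forall>y\<in>Y. is_path G y (p y) w \<and> length (p y) \<le> D \<and> v \<notin> set (p y) \<and> {v, y} \<in> edges G \<and> y \<noteq> w) \<longrightarrow>
    (\<forall>y\<in>Y. \<forall>y'\<in>Y. y \<noteq> y' \<longrightarrow> set (p y) \<inter> set (p y') = {w}) \<longrightarrow>
    contains_induced G {K. is_complete r K} \<or> contains_induced G {H. is_theta r H}"
    using complete_or_theta_of_paths[OF r, of D] ..
  obtain M where M: "\<forall>(H :: 'a graph) X root. finite X \<longrightarrow> M \<le> card X \<longrightarrow>
     (\<forall>x\<in>X. \<exists>xs. is_path H x xs root \<and> length xs \<le> D) \<longrightarrow>
     (\<exists>w Y p. Y \<subseteq> X \<and> card Y = Suc n \<and> (\<forall>y\<in>Y. is_path H y (p y) w \<and> length (p y) \<le> D) \<and>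
        (\<forall>y\<in>Y. \<forall>y'\<in>Y. y \<noteq> y' \<longrightarrow> set (p y) \<inter> set (p y') = {w}))"
    using many_paths_to_vertex[of D "Suc n"] ..
  show ?thesis
  \<comment> \<open>The factor \<open>r\<close> bounds the number of components that contain
    neighbours of \<open>v\<close>, and \<open>M\<close> the number of neighbours in each.\<close>
  proof (intro exI[of _ "r * M"] allI impI)
    fix G :: "'a graph" and v
    assume G: "simple_graph G" "k_edge_connected 2 G"
      and no_complete: "\<not> contains_induced G {K. is_complete r K}"
      and no_flower: "\<not> contains_induced G {H. is_flower r H}"
      and no_ladder: "\<not> contains_induced G {L. super_clean_pinched_ladder L \<and> card (verts L) \<ge> r}"
      and no_theta: "\<not> contains_induced G {H. is_theta r H}"
    let ?H = "del_vert G v" and ?N = "{x. {v, x} \<in> edges G}"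
    let ?comp = "\<lambda>x. {y. \<exists>zs. is_path ?H x zs y}"
    have H: "simple_graph ?H" unfolding del_vert_def using simple_graph_induced[OF G(1)] by simp
    have VH: "verts ?H = verts G - {v}" unfolding del_vert_def by simp
    have NV: "?N \<subseteq> verts ?H" using edges_simple[OF G(1)] unfolding VH by blast
    have finN: "finite ?N" using NV H finite_subset unfolding simple_graph_def by blast
    have self: "x \<in> ?comp x" if "x \<in> ?N" for x
    proof -
      have "is_path ?H x [x] x" using that NV by auto
      then show ?thesis by blast
    qed
    have small: "card (?N \<inter> ?comp x0) \<le> M" if x0: "x0 \<in> ?N" for x0
    proof (rule ccontr)
      assume "\<not> card (?N \<inter> ?comp x0) \<le> M"
      then have big: "M \<le> card (?N \<inter> ?comp x0)" by simp
      have "\<exists>xs. is_path ?H x xs x0 \<and> length xs \<le> D" if x: "x \<in> ?N \<inter> ?comp x0" for x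
      proof -
        obtain zs where zs: "is_path ?H x0 zs x" using x by blast
        obtain R where R: "is_induced_path ?H x R x0"
          using induced_path_exists[OF H is_path_rev[OF zs]] by metis
        have "length R \<le> D" unfolding D_def
          by (rule path_between_neighbours_bounded[OF G(1) induced_path_del_vert[OF R] _ _
              no_ladder no_flower])
            (use x x0 in auto)
        then show ?thesis using R unfolding is_induced_path_def by blast
      qed
      then have reach: "\<forall>x\<in>?N \<inter> ?comp x0. \<exists>xs. is_path ?H x xs x0 \<and> length xs \<le> D" by blast
      have fin: "finite (?N \<inter> ?comp x0)" using finN by simp
      from M[THEN spec, THEN spec, THEN spec, THEN mp, OF fin, THEN mp, OF big, THEN mp, OF reach]
      obtain w Y p where Y: "Y \<subseteq> ?N \<inter> ?comp x0" "card Y = Suc n"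
        and p: "\<forall>y\<in>Y. is_path ?H y (p y) w \<and> length (p y) \<le> D"
        and dis: "\<forall>y\<in>Y. \<forall>y'\<in>Y. y \<noteq> y' \<longrightarrow> set (p y) \<inter> set (p y') = {w}" by blast
      have finY: "finite Y" using Y(1) fin finite_subset by blast
      \<comment> \<open>The meeting vertex \<open>w\<close> may itself be one of the starting
        vertices, which the theta construction excludes. For this reason \<open>Suc n\<close> paths
        were requested.\<close>
      have "n \<le> card (Y - {w})" using Y(2) finY by (cases "w \<in> Y") auto
      then obtain Z where Z: "Z \<subseteq> Y - {w}" "card Z = n" "finite Z" by (rule
          obtain_subset_with_card_n)
      have pG: "is_path G y (p y) w" "v \<notin> set (p y)" if "y \<in> Y" for y
        using p that is_path_induced[of "verts G - {v}" G] unfolding del_vert_def by auto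
      have "Y \<noteq> {}" using Y(2) by auto
      then obtain y0 where y0: "y0 \<in> Y" by blast
      have vw: "v \<noteq> w" using pG[OF y0] is_path_ends[OF pG(1)[OF y0]] by blast
      have 1: "\<forall>y\<in>Z. is_path G y (p y) w \<and> length (p y) \<le> D \<and> v \<notin> set (p y) \<and> {v, y} \<in> edges G \<and> y
          \<noteq> w"
        using Z(1) Y(1) pG p by blast
      have 2: "\<forall>y\<in>Z. \<forall>y'\<in>Z. y \<noteq> y' \<longrightarrow> set (p y) \<inter> set (p y') = {w}" using Z(1) dis by blast
      from n[THEN spec, THEN spec, THEN spec, THEN spec, THEN spec, THEN mp, OF G(1), THEN mp, OF
          Z(3),
          THEN mp, OF Z(2), THEN mp, OF vw, THEN mp, OF 1, THEN mp, OF 2]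
      show False using no_complete no_theta by simp
    qed
    have "card ?N \<le> card (\<Union>K\<in>?comp ` ?N. ?N \<inter> K)"
      by (rule card_mono) (use finN self in auto)
    also have "\<dots> \<le> (\<Sum>K\<in>?comp ` ?N. card (?N \<inter> K))" by (rule card_UN_le) (use finN in simp)
    also have "\<dots> \<le> (\<Sum>K\<in>?comp ` ?N. M)" by (rule sum_mono) (use small in auto)
    also have "\<dots> = card (?comp ` ?N) * M" by simp
    also have "\<dots> \<le> r * M" using few_components[OF G no_flower, of v] by (intro mult_le_mono1) simp
    finally show "card ?N \<le> r * M" .
  qed
qed

theorem theorem1p9:
  fixes r :: nat
  assumes "r \<ge> 3"
  shows "\<exists>N :: nat. \<forall>G :: 'a graph.
    simple_graph G \<longrightarrow> k_edge_connected 2 G \<longrightarrow> card (verts G) \<ge> N \<longrightarrow>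
      contains_induced G {K. is_complete r K} \<or>
      contains_induced G {H. is_flower r H} \<or>
      contains_induced G {L. super_clean_pinched_ladder L \<and> card (verts L) \<ge> r} \<or>
      contains_induced G {H. ladder_chain r H} \<or>
      contains_induced G {H. is_theta r H}"
proof -
  have r: "2 \<le> r" "1 \<le> r" using assms by auto
  obtain d where d: "\<forall>(G :: 'a graph) v. simple_graph G \<longrightarrow> k_edge_connected 2 G \<longrightarrow>
    \<not> contains_induced G {K. is_complete r K} \<longrightarrow>
    \<not> contains_induced G {H. is_flower r H} \<longrightarrow>
    \<not> contains_induced G {L. super_clean_pinched_ladder L \<and> card (verts L) \<ge> r} \<longrightarrow>
    \<not> contains_induced G {H. is_theta r H} \<longrightarrow> card {x. {v, x} \<in> edges G} \<le> d"
    using degree_bounded[OF r(1)] ..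
  obtain M where M: "\<forall>(H :: 'a graph) X root. finite X \<longrightarrow> M \<le> card X \<longrightarrow>
     (\<forall>x\<in>X. \<exists>xs. is_path H x xs root \<and> length xs \<le> r * r) \<longrightarrow>
     (\<exists>w Y p. Y \<subseteq> X \<and> card Y = Suc (Suc d) \<and> (\<forall>y\<in>Y. is_path H y (p y) w \<and> length (p y) \<le> r * r) \<and>
        (\<forall>y\<in>Y. \<forall>y'\<in>Y. y \<noteq> y' \<longrightarrow> set (p y) \<inter> set (p y') = {w}))"
    using many_paths_to_vertex[of "r * r" "Suc (Suc d)"] ..
  show ?thesis
  proof (intro exI[of _ M] allI impI, rule ccontr)
    fix G :: "'a graph"
    assume G: "simple_graph G" "k_edge_connected 2 G" and big: "M \<le> card (verts G)"
      and "\<not> (contains_induced G {K. is_complete r K} \<or>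
        contains_induced G {H. is_flower r H} \<or>
        contains_induced G {L. super_clean_pinched_ladder L \<and> card (verts L) \<ge> r} \<or>
        contains_induced G {H. ladder_chain r H} \<or>
        contains_induced G {H. is_theta r H})"
    then have no: "\<not> contains_induced G {K. is_complete r K}" "\<not> contains_induced G {H. is_flower
        r H}"
      "\<not> contains_induced G {L. super_clean_pinched_ladder L \<and> card (verts L) \<ge> r}"
      "\<not> contains_induced G {H. ladder_chain r H}" "\<not> contains_induced G {H. is_theta r H}" by auto
    have fin: "finite (verts G)" using G(1) unfolding simple_graph_def by blast
    have "card (verts G) > 1" using G(2) unfolding k_edge_connected_def by blast
    then have "verts G \<noteq> {}" by auto
    then obtain root where root: "root \<in> verts G" by blast
    have reach: "\<forall>x\<in>verts G. \<exists>xs. is_path G x xs root \<and> length xs \<le> r * r"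
      using short_paths[OF G r(2) no(3,4) _ root] by blast
    from M[THEN spec, THEN spec, THEN spec, THEN mp, OF fin, THEN mp, OF big, THEN mp, OF reach]
    obtain w Y p where Y: "Y \<subseteq> verts G" "card Y = Suc (Suc d)"
      and p: "\<forall>y\<in>Y. is_path G y (p y) w \<and> length (p y) \<le> r * r"
      and dis: "\<forall>y\<in>Y. \<forall>y'\<in>Y. y \<noteq> y' \<longrightarrow> set (p y) \<inter> set (p y') = {w}" by blast
    have finY: "finite Y" using Y(1) fin finite_subset by blast
    \<comment> \<open>Two more paths than the degree bound were requested: one may be lost to
      \<open>w\<close> itself, and \<open>Suc d\<close> remain to exceed the bound.\<close>
    have "Suc d \<le> card (Y - {w})" using Y(2) finY by (cases "w \<in> Y") auto
    also have "\<dots> \<le> card {x. {w, x} \<in> edges G}"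
    \<comment> \<open>Each remaining path is mapped to its last vertex before \<open>w\<close>. This
      is a neighbour of \<open>w\<close>, and it determines the path because two paths share only
      \<open>w\<close>.\<close>
    proof (rule card_inj_on_le[where f = "\<lambda>y. last (butlast (p y))"])
      have q: "last (butlast (p y)) \<in> set (p y) - {w} \<and> {w, last (butlast (p y))} \<in> edges G"
        if y: "y \<in> Y - {w}" for y
      proof -
        have py: "is_path G y (p y) w" using p y by blast
        have ends: "p y \<noteq> []" "hd (p y) = y" "last (p y) = w" using is_path_ends[OF py] by auto
        have eq: "butlast (p y) @ [w] = p y" using append_butlast_last_id[OF ends(1)] ends(3) by
            simp
        have ne: "butlast (p y) \<noteq> []"
        proof
          assume "butlast (p y) = []"
          then have "p y = [w]" using eq by simp
          then show False using ends(2) y by simp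
        qed
        have "is_path G y (butlast (p y) @ [w]) w" unfolding eq by (rule py)
        then have "{last (butlast (p y)), w} \<in> edges G" "w \<notin> set (butlast (p y))"
          using is_path_append[OF ne, of "[w]"] by auto
        moreover have "last (butlast (p y)) \<in> set (butlast (p y))" using ne by simp
        ultimately show ?thesis by (auto simp: insert_commute dest: in_set_butlastD)
      qed
      show "inj_on (\<lambda>y. last (butlast (p y))) (Y - {w})"
      proof (rule inj_onI, rule ccontr)
        fix y y' assume y: "y \<in> Y - {w}" "y' \<in> Y - {w}" and eq: "last (butlast (p y)) = last
            (butlast (p y'))"
          and ne: "y \<noteq> y'"
        have "set (p y) \<inter> set (p y') = {w}" using dis y ne by blast
        moreover have "last (butlast (p y)) \<in> set (p y) \<inter> set (p y')" using q[OF y(1)] q[OF y(2)]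
            eq by simp
        ultimately show False using q[OF y(1)] by simp
      qed
      show "(\<lambda>y. last (butlast (p y))) ` (Y - {w}) \<subseteq> {x. {w, x} \<in> edges G}" using q by blast
      show "finite {x. {w, x} \<in> edges G}"
        by (rule finite_subset[OF _ fin]) (use edges_simple[OF G(1)] in blast)
    qed
    finally show False
      using d[THEN spec, THEN spec, THEN mp, OF G(1), THEN mp, OF G(2), THEN mp, OF no(1), THEN
          mp, OF no(2),
          THEN mp, OF no(3), THEN mp, OF no(5), of w] by simp
  qed
qed

end
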